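(* Let $n\geqslant 2$ and let $A$ be a convex body in $\mathbb{R}^n$. Then for any pair of convex bodies $K_1,K_2$ in $\mathbb{R}^n$, $$|A|\,V(K_1,K_2,A[n-2])\leqslant 2\,V(K_1,A[n-1])\,V(K_2,A[n-1]).$$ *)

theory Defs
  imports "HOL-Analysis.Analysis" "HOL-Library.Set_Algebras"
begin

definition convex_body :: "(real^'n::finite) set \<Rightarrow> bool" where
  "convex_body K \<longleftrightarrow> compact K \<and> convex K \<and> K \<noteq> {}"

text \<open>Mixed volume V(K_0,...,K_{n-1}) of n = CARD('n) sets, given as a list,
  defined by the polarization formula
  V(K_1..K_n) = 1/n! * sum over nonempty S of (-1)^(n-|S|) * vol(sum_{i in S} K_i),
  where the inner sum is the Minkowski sum.\<close>
definition mixed_volume :: "(real^'n::finite) set list \<Rightarrow> real" where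
  "mixed_volume Ks =
     (1 / fact CARD('n)) *
     (\<Sum>S\<in>{S. S \<subseteq> {..<CARD('n)} \<and> S \<noteq> {}}.
        (-1) ^ (CARD('n) - card S) * measure lebesgue (\<Sum>i\<in>S. Ks ! i))"

end

theory Submission
  imports Defs "HOL-Probability.Distribution_Functions"
begin

text \<open>
  For polytopes \<open>K j = conv (P j)\<close> with interior points, the gradient of
  \<open>\<Sum>j. a j * ln (\<Sum>v\<in>P j. exp (x \<bullet> v))\<close> maps the whole space injectively onto
  \<open>\<Sum>j. a j *\<^sub>R K j\<close> up to its boundary. Its Jacobian is a Gram matrix, so the change of variables
  formula and the Cauchy-Binet expansion show that the volume of \<open>\<Sum>j. a j *\<^sub>R K j\<close> is a polynomial
  in \<open>a\<close> with nonnegative coefficients. Polarization identifies these with the mixed volumes, which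
  therefore are nonnegative and multilinear; general bodies are limits of polytopes.

  By Brunn-Minkowski, \<open>|A + t L|^(1/n)\<close> is concave in \<open>t\<close>. Comparing second-order coefficients at
  \<open>t = 0\<close> gives Minkowski's inequality \<open>|A| V(L, L, A[n-2]) \<le> V(L, A[n-1])^2\<close>. Taking
  \<open>L = x K1 + y K2\<close> and dropping the nonnegative terms \<open>V(Ki, Ki, A[n-2])\<close> yields
  \<open>2 x y |A| V(K1, K2, A[n-2]) \<le> (x V(K1, A[n-1]) + y V(K2, A[n-1]))^2\<close>, and the claim follows for
  \<open>x = V(K2, A[n-1])\<close>, \<open>y = V(K1, A[n-1])\<close>.
\<close>

section \<open>Outer approximation of compact sets\<close>

lemma compact_set_plus:
  fixes X Y :: "'a::real_normed_vector set"
  assumes "compact X" "compact Y"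
  shows "compact (X + Y)"
proof -
  have "X + Y = {x + y | x y. x \<in> X \<and> y \<in> Y}" by (auto simp: set_plus_def)
  then show ?thesis using compact_sums[OF assms] by simp
qed

lemma compact_set_sum:
  fixes X :: "'i \<Rightarrow> 'a::real_normed_vector set"
  assumes "\<And>i. i \<in> S \<Longrightarrow> compact (X i)"
  shows "compact (\<Sum>i\<in>S. X i)"
  using assms
  by (induction S rule: infinite_finite_induct) (auto simp: set_zero intro!: compact_set_plus)

lemma cball_0_plus_cball_0:
  "cball 0 r + cball 0 s \<subseteq> cball (0 :: 'a::real_normed_vector) (r + s)"
  by (auto elim!: set_plus_elim intro!: norm_triangle_le add_mono)

definition outer_approximates :: "(nat \<Rightarrow> 'a::real_normed_vector set) \<Rightarrow> 'a set \<Rightarrow> bool" where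
  "outer_approximates Y X \<longleftrightarrow> compact X \<and> (\<forall>m. compact (Y m) \<and> X \<subseteq> Y m)
     \<and> (\<exists>r\<ge>0. \<forall>m. Y m \<subseteq> X + cball 0 (r / Suc m))"

lemma outer_approximatesI:
  assumes "compact X" "\<And>m. compact (Y m)" "\<And>m. X \<subseteq> Y m" "0 \<le> r" "\<And>m. Y m \<subseteq> X + cball 0 (r / Suc m)"
  shows "outer_approximates Y X"
  using assms unfolding outer_approximates_def by blast

lemma outer_approximatesE:
  assumes "outer_approximates Y X"
  obtains r where "compact X" "\<And>m. compact (Y m)" "\<And>m. X \<subseteq> Y m"
    "0 \<le> r" "\<And>m. Y m \<subseteq> X + cball 0 (r / Suc m)"
  using assms unfolding outer_approximates_def by metis

lemma outer_approximates_const: "compact X \<Longrightarrow> outer_approximates (\<lambda>_. X) X"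
  by (rule outer_approximatesI[where r = 0]) simp_all

lemma outer_approximates_plus:
  assumes "outer_approximates Y X" "outer_approximates Y' X'"
  shows "outer_approximates (\<lambda>m. Y m + Y' m) (X + X')"
proof -
  obtain r where X_approx: "compact X" "\<And>m. compact (Y m)" "\<And>m. X \<subseteq> Y m"
      "0 \<le> r" "\<And>m. Y m \<subseteq> X + cball 0 (r / Suc m)"
    using outer_approximatesE[OF assms(1)] by blast
  obtain r' where X'_approx: "compact X'" "\<And>m. compact (Y' m)" "\<And>m. X' \<subseteq> Y' m"
      "0 \<le> r'" "\<And>m. Y' m \<subseteq> X' + cball 0 (r' / Suc m)"
    using outer_approximatesE[OF assms(2)] by blast
  have "Y m + Y' m \<subseteq> (X + X') + cball 0 ((r + r') / Suc m)" for m
  proof -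
    have "Y m + Y' m \<subseteq> (X + cball 0 (r / Suc m)) + (X' + cball 0 (r' / Suc m))"
      by (intro set_plus_mono2 X_approx(5) X'_approx(5))
    also have "\<dots> = (X + X') + (cball 0 (r / Suc m) + cball 0 (r' / Suc m))" by (simp only: add_ac)
    also have "\<dots> \<subseteq> (X + X') + cball 0 (r / Suc m + r' / Suc m)"
      by (intro set_plus_mono2 subset_refl cball_0_plus_cball_0)
    finally show ?thesis by (simp only: add_divide_distrib)
  qed
  moreover have "X + X' \<subseteq> Y m + Y' m" for m by (intro set_plus_mono2 X_approx(3) X'_approx(3))
  ultimately show ?thesis
    using X_approx(1,2,4) X'_approx(1,2,4)
    by (intro outer_approximatesI[where r = "r + r'"] compact_set_plus add_nonneg_nonneg)
qed

lemma outer_approximates_sum: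
  assumes "\<And>i. i \<in> S \<Longrightarrow> outer_approximates (Y i) (X i)"
  shows "outer_approximates (\<lambda>m. \<Sum>i\<in>S. Y i m) (\<Sum>i\<in>S. X i)"
  using assms
proof (induction S rule: infinite_finite_induct)
  case (insert i S)
  then show ?case using outer_approximates_plus[of "Y i" "X i"] by simp
qed (simp_all add: outer_approximates_const set_zero)

lemma outer_approximates_scaleR:
  assumes "outer_approximates Y X"
  shows "outer_approximates (\<lambda>m. (*\<^sub>R) c ` Y m) ((*\<^sub>R) c ` X)"
proof -
  obtain r where approx: "compact X" "\<And>m. compact (Y m)" "\<And>m. X \<subseteq> Y m"
      "0 \<le> r" "\<And>m. Y m \<subseteq> X + cball 0 (r / Suc m)"
    using outer_approximatesE[OF assms] by blast
  have "(*\<^sub>R) c ` Y m \<subseteq> (*\<^sub>R) c ` X + cball 0 (\<bar>c\<bar> * r / Suc m)" for m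
  proof (intro subsetI, elim imageE)
    fix z y assume "z = c *\<^sub>R y" "y \<in> Y m"
    then obtain x b where "z = c *\<^sub>R x + c *\<^sub>R b" "x \<in> X" "norm b \<le> r / Suc m"
      using approx(5)[of m] by (fastforce simp: scaleR_add_right elim!: set_plus_elim)
    moreover from this have "norm (c *\<^sub>R b) \<le> \<bar>c\<bar> * (r / Suc m)"
      unfolding norm_scaleR by (intro mult_left_mono) auto
    ultimately show "z \<in> (*\<^sub>R) c ` X + cball 0 (\<bar>c\<bar> * r / Suc m)"
      by (auto intro!: set_plus_intro)
  qed
  then show ?thesis
    using approx
    by (intro outer_approximatesI[where r = "\<bar>c\<bar> * r"]
        compact_scaling image_mono mult_nonneg_nonneg) auto
qed

lemma Inter_plus_cball:
  fixes X :: "'a::real_normed_vector set"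
  assumes "compact X" "0 \<le> r"
  shows "(\<Inter>m. X + cball 0 (r / Suc m)) = X"
proof
  show "X \<subseteq> (\<Inter>m. X + cball 0 (r / Suc m))"
    unfolding add.commute[of X] using assms(2) by (intro INT_greatest set_zero_plus2) simp
  show "(\<Inter>m. X + cball 0 (r / Suc m)) \<subseteq> X"
  proof
    fix x assume mem: "x \<in> (\<Inter>m. X + cball 0 (r / Suc m))"
    have "\<exists>y\<in>X. dist y x < e" if "0 < e" for e
    proof -
      have "(\<lambda>m. r / Suc m) \<longlonglongrightarrow> 0" by (rule LIMSEQ_Suc[OF lim_const_over_n])
      then obtain m where "r / Suc m < e"
        using order_tendstoD(2)[OF _ \<open>0 < e\<close>] by (fastforce simp: eventually_sequentially)
      moreover have "x \<in> X + cball 0 (r / Suc m)" using mem by blast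
      then obtain y z where "y \<in> X" "norm z \<le> r / Suc m" "x = y + z" by (auto elim!: set_plus_elim)
      ultimately show ?thesis by (intro bexI[of _ y]) (auto simp: dist_norm)
    qed
    then show "x \<in> X"
      using assms(1) by (metis closure_approachable closure_closed compact_imp_closed)
  qed
qed

lemma measure_plus_cball_tendsto:
  fixes X :: "'a::euclidean_space set"
  assumes "compact X" "0 \<le> r"
  shows "(\<lambda>m. measure lebesgue (X + cball 0 (r / Suc m))) \<longlonglongrightarrow> measure lebesgue X"
proof -
  have meas: "X + cball 0 (r / Suc m) \<in> lmeasurable" for m
    by (intro lmeasurable_compact compact_set_plus assms(1) compact_cball)
  have "(\<lambda>m. measure lebesgue (X + cball 0 (r / Suc m)))
      \<longlonglongrightarrow> measure lebesgue (\<Inter>m. X + cball 0 (r / Suc m))"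
  proof (rule Lim_measure_decseq)
    show "range (\<lambda>m. X + cball 0 (r / Suc m)) \<subseteq> sets lebesgue"
      using meas by (auto intro: fmeasurableD)
    show "decseq (\<lambda>m. X + cball 0 (r / Suc m))"
      unfolding decseq_def
      by (intro allI impI set_plus_mono2 subset_refl subset_cball divide_left_mono)
        (auto simp: assms(2))
    show "emeasure lebesgue (X + cball 0 (r / Suc m)) \<noteq> \<infinity>" for m
      unfolding infinity_ennreal_def by (rule fmeasurableD2[OF meas])
  qed
  then show ?thesis by (simp only: Inter_plus_cball[OF assms])
qed

lemma measure_outer_approximates_tendsto:
  fixes X :: "'a::euclidean_space set"
  assumes "outer_approximates Y X"
  shows "(\<lambda>m. measure lebesgue (Y m)) \<longlonglongrightarrow> measure lebesgue X"
proof -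
  obtain r where compact: "compact X" "\<And>m. compact (Y m)" and subset: "\<And>m. X \<subseteq> Y m"
      and within: "0 \<le> r" "\<And>m. Y m \<subseteq> X + cball 0 (r / Suc m)"
    using outer_approximatesE[OF assms] by blast
  show ?thesis
  proof (rule tendsto_sandwich[OF _ _ tendsto_const
        measure_plus_cball_tendsto[OF compact(1) within(1)]])
    show "\<forall>\<^sub>F m in sequentially. measure lebesgue X \<le> measure lebesgue (Y m)"
      using subset
      by (intro always_eventually allI measure_mono_fmeasurable fmeasurableD
          lmeasurable_compact compact)
    show "\<forall>\<^sub>F m in sequentially. measure lebesgue (Y m)
        \<le> measure lebesgue (X + cball 0 (r / Suc m))"
      using within(2)
      by (intro always_eventually allI measure_mono_fmeasurable fmeasurableD lmeasurable_compact
        compact_set_plus compact compact_cball)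
  qed
qed

section \<open>The Brunn-Minkowski inequality\<close>

definition root_volume :: "'a::euclidean_space set \<Rightarrow> real" where
  "root_volume S = root DIM('a) (measure lebesgue S)"

lemma root_volume_nonneg [simp]: "0 \<le> root_volume S"
  by (simp add: root_volume_def)

lemma root_volume_power:
  fixes S :: "'a::euclidean_space set"
  shows "root_volume S ^ DIM('a) = measure lebesgue S"
  by (simp add: root_volume_def real_root_pow_pos2)

lemma root_volume_mono:
  assumes "S \<subseteq> T" "S \<in> lmeasurable" "T \<in> lmeasurable"
  shows "root_volume S \<le> root_volume T"
  unfolding root_volume_def using assms
  by (intro real_root_le_mono measure_mono_fmeasurable fmeasurableD) auto

definition brunn_minkowski :: "'a::euclidean_space set \<Rightarrow> 'a set \<Rightarrow> bool" where
  "brunn_minkowski X Y \<longleftrightarrow> root_volume X + root_volume Y \<le> root_volume (X + Y)"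

lemma brunn_minkowski_commute: "brunn_minkowski X Y \<longleftrightarrow> brunn_minkowski Y X"
  by (simp add: brunn_minkowski_def add.commute)

lemma brunn_minkowski_iff_power:
  fixes X Y :: "'a::euclidean_space set"
  shows "brunn_minkowski X Y \<longleftrightarrow> (root_volume X + root_volume Y) ^ DIM('a) \<le> measure lebesgue (X + Y)"
  unfolding brunn_minkowski_def root_volume_power[symmetric] by (simp add: power_mono_iff)

lemma open_set_plus:
  fixes X Y :: "'a::real_normed_vector set"
  assumes "open Y"
  shows "open (X + Y)"
proof -
  have "X + Y = (\<Union>x\<in>X. (+) x ` Y)" by (auto simp: set_plus_def)
  then show ?thesis using assms by (auto intro: open_translation)
qed

lemma bounded_set_plus:
  fixes X Y :: "'a::real_normed_vector set"
  assumes "bounded X" "bounded Y"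
  shows "bounded (X + Y)"
  using bounded_plus[OF assms] by (simp add: set_plus_image)

lemma lmeasurable_open_set_plus:
  fixes X Y :: "'a::euclidean_space set"
  assumes "bounded X" "open Y" "bounded Y"
  shows "X + Y \<in> lmeasurable"
  using assms by (intro lmeasurable_open open_set_plus bounded_set_plus)

lemma measure_open_pos:
  fixes S :: "'a::euclidean_space set"
  assumes "open S" "bounded S" "S \<noteq> {}"
  shows "0 < measure lebesgue S"
  using open_not_negligible[OF assms(1,3)] lmeasurable_open[OF assms(2,1)]
  by (simp add: negligible_iff_measure zero_less_measure_iff)

subsection \<open>Boxes\<close>

lemma root_prod_add_le:
  fixes u v :: "'a \<Rightarrow> real"
  assumes index: "finite I" "I \<noteq> {}"
    and u_nonneg: "\<And>i. i \<in> I \<Longrightarrow> 0 \<le> u i" and v_nonneg: "\<And>i. i \<in> I \<Longrightarrow> 0 \<le> v i"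
  shows "root (card I) (\<Prod>i\<in>I. u i) + root (card I) (\<Prod>i\<in>I. v i) \<le> root (card I) (\<Prod>i\<in>I. u i + v i)"
proof (cases "\<exists>i\<in>I. u i + v i = 0")
  case True
  then obtain i where "i \<in> I" "u i = 0" "v i = 0"
    using u_nonneg v_nonneg by (metis add_nonneg_eq_0_iff)
  then have "(\<Prod>i\<in>I. u i) = 0" "(\<Prod>i\<in>I. v i) = 0" "(\<Prod>i\<in>I. u i + v i) = 0"
    using index(1) by force+
  then show ?thesis by simp
next
  case False
  have card_pos: "0 < card I" using index by (simp add: card_gt_0_iff)
  have sum_pos: "0 < u i + v i" if "i \<in> I" for i
    using False that u_nonneg v_nonneg by (metis add_nonneg_nonneg order_le_less)
  have amgm: "root (card I) (\<Prod>i\<in>I. f i / (u i + v i)) \<le> (\<Sum>i\<in>I. f i / (u i + v i)) / card I"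
    if "\<And>i. i \<in> I \<Longrightarrow> 0 \<le> f i" for f
    using arith_geom_mean[OF index, of "\<lambda>i. f i / (u i + v i)"] that sum_pos card_pos
    by (simp add: root_powr_inverse prod_nonneg sum_divide_distrib less_imp_le)
  have "(\<Sum>i\<in>I. u i / (u i + v i)) + (\<Sum>i\<in>I. v i / (u i + v i)) = (\<Sum>i\<in>I. 1)"
    unfolding sum.distrib[symmetric] add_divide_distrib[symmetric]
    using sum_pos by (intro sum.cong) (auto simp: less_imp_neq[symmetric])
  then have "root (card I) (\<Prod>i\<in>I. u i / (u i + v i)) + root (card I) (\<Prod>i\<in>I. v i / (u i + v i)) \<le> 1"
    using add_mono[OF amgm[of u] amgm[of v]] u_nonneg v_nonneg card_pos
    by (simp add: add_divide_distrib[symmetric])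
  then have "(root (card I) (\<Prod>i\<in>I. u i) + root (card I) (\<Prod>i\<in>I. v i))
      / root (card I) (\<Prod>i\<in>I. u i + v i) \<le> 1"
    using card_pos by (simp add: prod_dividef real_root_divide add_divide_distrib)
  moreover have "0 < root (card I) (\<Prod>i\<in>I. u i + v i)"
    using sum_pos card_pos by (simp add: prod_pos)
  ultimately show ?thesis by (simp add: divide_le_eq)
qed

lemma box_add_subset:
  fixes a b c d :: "'a::euclidean_space"
  assumes "box a b \<noteq> {}" "box c d \<noteq> {}"
  shows "box (a + c) (b + d) \<subseteq> box a b + box c d"
proof
  fix x assume mem: "x \<in> box (a + c) (b + d)"
  have "\<exists>t. a \<bullet> i < t \<and> t < b \<bullet> i \<and> c \<bullet> i < x \<bullet> i - t \<and> x \<bullet> i - t < d \<bullet> i" if "i \<in> Basis" for i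
  proof -
    have "max (a \<bullet> i) (x \<bullet> i - d \<bullet> i) < min (b \<bullet> i) (x \<bullet> i - c \<bullet> i)"
      using mem assms that by (auto simp: mem_box box_ne_empty inner_add_left)
    then obtain t where "max (a \<bullet> i) (x \<bullet> i - d \<bullet> i) < t" "t < min (b \<bullet> i) (x \<bullet> i - c \<bullet> i)"
      using dense by blast
    then show ?thesis by (intro exI[of _ t]) auto
  qed
  then obtain t where split_coords: "\<And>i. i \<in> Basis \<Longrightarrow>
      a \<bullet> i < t i \<and> t i < b \<bullet> i \<and> c \<bullet> i < x \<bullet> i - t i \<and> x \<bullet> i - t i < d \<bullet> i"
    by metis
  define y where "y = (\<Sum>i\<in>Basis. t i *\<^sub>R i)"
  have "y \<in> box a b" "x - y \<in> box c d"
    using split_coords by (simp_all add: y_def mem_box inner_diff_left)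
  then show "x \<in> box a b + box c d"
    using set_plus_intro by fastforce
qed

lemma brunn_minkowski_box:
  fixes a b c d :: "'a::euclidean_space"
  assumes "box a b \<noteq> {}" "box c d \<noteq> {}"
  shows "brunn_minkowski (box a b) (box c d)"
proof -
  have less: "a \<bullet> i < b \<bullet> i" "c \<bullet> i < d \<bullet> i" "(a + c) \<bullet> i < (b + d) \<bullet> i" if "i \<in> Basis" for i
    using assms that by (auto simp: box_ne_empty inner_add_left add_strict_mono)
  then have volume: "measure lebesgue (box a b) = (\<Prod>i\<in>Basis. (b - a) \<bullet> i)"
    "measure lebesgue (box c d) = (\<Prod>i\<in>Basis. (d - c) \<bullet> i)"
    "measure lebesgue (box (a + c) (b + d)) = (\<Prod>i\<in>Basis. (b + d - (a + c)) \<bullet> i)"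
    by (simp_all add: measure_lborel_box_eq less_imp_le)
  have "root_volume (box a b) + root_volume (box c d)
      \<le> root DIM('a) (\<Prod>i\<in>Basis. (b - a) \<bullet> i + (d - c) \<bullet> i)"
    unfolding root_volume_def volume using less
    by (intro root_prod_add_le[of "Basis :: 'a set"]) (simp_all add: inner_diff_left less_imp_le)
  also have "\<dots> = root_volume (box (a + c) (b + d))"
    unfolding root_volume_def volume by (simp add: inner_simps algebra_simps)
  also have "\<dots> \<le> root_volume (box a b + box c d)"
    by (intro root_volume_mono box_add_subset[OF assms] lmeasurable_open_set_plus) auto
  finally show ?thesis by (simp only: brunn_minkowski_def)
qed

subsection \<open>Cutting by hyperplanes\<close>

lemma measure_split_hyperplane:
  fixes X :: "'a::euclidean_space set"
  assumes "X \<in> lmeasurable" "i \<in> Basis"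
  shows "measure lebesgue X
    = measure lebesgue (X \<inter> {x. x \<bullet> i < c}) + measure lebesgue (X \<inter> {x. c < x \<bullet> i})"
proof -
  have halves: "X \<inter> {x. x \<bullet> i < c} \<in> lmeasurable" "X \<inter> {x. c < x \<bullet> i} \<in> lmeasurable"
    using assms
    by (auto intro!: fmeasurable_Int_fmeasurable
      simp: borel_open open_halfspace_component_lt open_halfspace_component_gt)
  have "measure lebesgue X = measure lebesgue ((X \<inter> {x. x \<bullet> i < c}) \<union> (X \<inter> {x. c < x \<bullet> i}))"
    by (rule measure_negligible_symdiff[symmetric])
      (use assms in \<open>auto intro: negligible_subset[OF negligible_standard_hyperplane[of i c]]\<close>)
  also have "\<dots> = measure lebesgue (X \<inter> {x. x \<bullet> i < c}) + measure lebesgue (X \<inter> {x. c < x \<bullet> i})"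
  proof -
    have "(X \<inter> {x. x \<bullet> i < c}) \<inter> (X \<inter> {x. c < x \<bullet> i}) = {}" by auto
    then show ?thesis using measure_Un3[OF halves] by simp
  qed
  finally show ?thesis .
qed

lemma measure_Int_halfspace:
  fixes Y :: "'a::euclidean_space set"
  assumes meas_Y: "Y \<in> lmeasurable" and basis: "i \<in> Basis"
  shows "isCont (\<lambda>d. measure lebesgue (Y \<inter> {x. x \<bullet> i < d})) d"
    and "((\<lambda>d. measure lebesgue (Y \<inter> {x. x \<bullet> i < d})) \<longlongrightarrow> 0) at_bot"
    and "((\<lambda>d. measure lebesgue (Y \<inter> {x. x \<bullet> i < d})) \<longlongrightarrow> measure lebesgue Y) at_top"
proof -
  have proj: "(\<lambda>x. x \<bullet> i) \<in> borel_measurable (lebesgue_on Y)"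
    by (intro measurable_restrict_space1 measurable_completion) simp
  define M where "M = distr (lebesgue_on Y) borel (\<lambda>x. x \<bullet> i)"
  have measure_M: "measure M S = measure lebesgue (Y \<inter> {x. x \<bullet> i \<in> S})" if "S \<in> sets borel" for S
    using that meas_Y proj
    by (simp add: M_def measure_distr measure_restrict_space fmeasurableD space_restrict_space
      Int_commute vimage_def)
  interpret Y: finite_measure "lebesgue_on Y" using meas_Y by (rule finite_measure_lebesgue_on)
  interpret M: finite_borel_measure M
    using Y.finite_measure_distr[OF proj]
    by (simp add: M_def finite_borel_measure_def finite_borel_measure_axioms_def)
  have no_atoms: "measure M {d} = 0" for d
    using negligible_subset[OF negligible_standard_hyperplane[OF basis],
        of "Y \<inter> {x. x \<bullet> i \<in> {d}}" d]
    by (subst measure_M) (auto intro: negligible_imp_measure0)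
  have cdf_eq: "cdf M d = measure lebesgue (Y \<inter> {x. x \<bullet> i < d})" for d
  proof -
    have "cdf M d = measure M ({..<d} \<union> {d})" by (simp only: cdf_def ivl_disj_un_singleton)
    also have "\<dots> = measure M {..<d}"
      using no_atoms by (subst M.finite_measure_Union) auto
    finally show ?thesis by (simp add: measure_M)
  qed
  have total: "measure M (space M) = measure lebesgue Y" by (simp add: M.borel_UNIV measure_M)
  show "isCont (\<lambda>d. measure lebesgue (Y \<inter> {x. x \<bullet> i < d})) d"
    using no_atoms by (simp only: cdf_eq[symmetric] M.isCont_cdf)
  show "((\<lambda>d. measure lebesgue (Y \<inter> {x. x \<bullet> i < d})) \<longlongrightarrow> 0) at_bot"
    using M.cdf_lim_at_bot by (simp only: cdf_eq[symmetric])
  show "((\<lambda>d. measure lebesgue (Y \<inter> {x. x \<bullet> i < d})) \<longlongrightarrow> measure lebesgue Y) at_top"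
    using M.cdf_lim_at_top by (simp only: cdf_eq[symmetric] total)
qed

lemma hyperplane_cut_exists:
  fixes Y :: "'a::euclidean_space set"
  assumes meas_pos: "Y \<in> lmeasurable" "0 < measure lebesgue Y" and basis: "i \<in> Basis"
    and ratio: "0 < l" "l < 1"
  shows "\<exists>d. measure lebesgue (Y \<inter> {x. x \<bullet> i < d}) = l * measure lebesgue Y"
proof -
  define g where "g d = measure lebesgue (Y \<inter> {x. x \<bullet> i < d})" for d
  note g_props = measure_Int_halfspace[OF meas_pos(1) basis, folded g_def]
  have "\<forall>\<^sub>F d in at_bot. g d < l * measure lebesgue Y"
    using g_props(2) ratio meas_pos(2) by (intro order_tendstoD(2)) auto
  then obtain a where below: "\<And>d. d \<le> a \<Longrightarrow> g d < l * measure lebesgue Y"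
    by (auto simp: eventually_at_bot_linorder)
  have "\<forall>\<^sub>F d in at_top. l * measure lebesgue Y < g d"
    using g_props(3) ratio meas_pos(2) by (intro order_tendstoD(1)) auto
  then obtain b where above: "\<And>d. b \<le> d \<Longrightarrow> l * measure lebesgue Y < g d"
    by (auto simp: eventually_at_top_linorder)
  have "g (min a b) \<le> l * measure lebesgue Y" "l * measure lebesgue Y \<le> g (max a b)"
    using below[of "min a b"] above[of "max a b"] by simp_all
  moreover have "min a b \<le> max a b" by simp
  ultimately obtain d where "g d = l * measure lebesgue Y"
    using IVT[of g "min a b" _ "max a b"] g_props(1) by blast
  then show ?thesis by (auto simp: g_def)
qed

lemma brunn_minkowski_parallel_cuts:
  fixes X Y :: "'a::euclidean_space set"
  assumes open_X: "open X" "bounded X" and open_Y: "open Y" "bounded Y"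
    and basis: "i \<in> Basis" and ratio: "0 \<le> l" "l \<le> 1"
    and cut: "measure lebesgue (X \<inter> {x. x \<bullet> i < c}) = l * measure lebesgue X"
      "measure lebesgue (Y \<inter> {x. x \<bullet> i < d}) = l * measure lebesgue Y"
    and lower: "brunn_minkowski (X \<inter> {x. x \<bullet> i < c}) (Y \<inter> {x. x \<bullet> i < d})"
    and upper: "brunn_minkowski (X \<inter> {x. c < x \<bullet> i}) (Y \<inter> {x. d < x \<bullet> i})"
  shows "brunn_minkowski X Y"
proof -
  define XL YL where "XL = X \<inter> {x. x \<bullet> i < c}" and "YL = Y \<inter> {x. x \<bullet> i < d}"
  define XU YU where "XU = X \<inter> {x. c < x \<bullet> i}" and "YU = Y \<inter> {x. d < x \<bullet> i}"
  have meas: "X + Y \<in> lmeasurable" "XL + YL \<in> lmeasurable" "XU + YU \<in> lmeasurable"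
    unfolding XL_def YL_def XU_def YU_def using open_X open_Y
    by (auto intro!: lmeasurable_open_set_plus open_halfspace_component_lt
      open_halfspace_component_gt intro: bounded_subset)
  have "measure lebesgue XU = (1 - l) * measure lebesgue X"
      "measure lebesgue YU = (1 - l) * measure lebesgue Y"
    using measure_split_hyperplane[OF lmeasurable_open[OF open_X(2,1)] basis, of c]
      measure_split_hyperplane[OF lmeasurable_open[OF open_Y(2,1)] basis, of d] cut
    by (simp_all add: XU_def YU_def algebra_simps)
  then have roots: "root_volume XL = root DIM('a) l * root_volume X"
      "root_volume YL = root DIM('a) l * root_volume Y"
      "root_volume XU = root DIM('a) (1 - l) * root_volume X"
      "root_volume YU = root DIM('a) (1 - l) * root_volume Y"
    using cut by (simp_all add: root_volume_def XL_def YL_def real_root_mult)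
  have "z \<bullet> i < c + d" if "z \<in> XL + YL" for z
    using that
    by (auto simp: XL_def YL_def inner_add_left elim!: set_plus_elim intro: add_strict_mono)
  moreover have "c + d < z \<bullet> i" if "z \<in> XU + YU" for z
    using that
    by (auto simp: XU_def YU_def inner_add_left elim!: set_plus_elim intro: add_strict_mono)
  ultimately have disjoint: "(XL + YL) \<inter> (XU + YU) = {}" by fastforce
  have "(root_volume X + root_volume Y) ^ DIM('a)
      = (root_volume XL + root_volume YL) ^ DIM('a) + (root_volume XU + root_volume YU) ^ DIM('a)"
    using ratio unfolding roots distrib_left[symmetric] power_mult_distrib
    by (simp add: real_root_pow_pos2 distrib_right[symmetric])
  also have "\<dots> \<le> measure lebesgue (XL + YL) + measure lebesgue (XU + YU)"
    using lower upper unfolding brunn_minkowski_iff_power XL_def YL_def XU_def YU_def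
    by (intro add_mono)
  also have "\<dots> = measure lebesgue ((XL + YL) \<union> (XU + YU))"
    using measure_Un3[OF meas(2,3)] by (simp add: disjoint)
  also have "\<dots> \<le> measure lebesgue (X + Y)"
    using meas by (intro measure_mono_fmeasurable)
      (auto simp: XL_def YL_def XU_def YU_def elim!: set_plus_elim)
  finally show ?thesis by (simp only: brunn_minkowski_iff_power)
qed

subsection \<open>Finite unions of disjoint boxes\<close>

definition box_family :: "'a::euclidean_space set set \<Rightarrow> bool" where
  "box_family F \<longleftrightarrow> finite F \<and> F \<noteq> {} \<and> disjoint F \<and> (\<forall>B\<in>F. B \<noteq> {} \<and> (\<exists>a b. B = box a b))"

lemma box_family_Union:
  assumes "box_family F"
  shows "open (\<Union>F)" "bounded (\<Union>F)" "\<Union>F \<noteq> {}"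
proof -
  show "open (\<Union>F)" using assms unfolding box_family_def by (metis open_Union open_box)
  show "bounded (\<Union>F)" using assms unfolding box_family_def by (metis bounded_Union bounded_box)
  show "\<Union>F \<noteq> {}" using assms unfolding box_family_def by auto
qed

definition restrict_family :: "'a set set \<Rightarrow> 'a set \<Rightarrow> 'a set set" where
  "restrict_family F H = (\<lambda>B. B \<inter> H) ` F - {{}}"

lemma Union_restrict_family: "\<Union>(restrict_family F H) = \<Union>F \<inter> H"
  by (auto simp: restrict_family_def)

lemma box_family_restrict_family:
  assumes family: "box_family F" and cuts_boxes: "\<And>a b. \<exists>a' b'. box a b \<inter> H = box a' b'"
    and nonempty: "\<Union>F \<inter> H \<noteq> {}"
  shows "box_family (restrict_family F H)"
  unfolding box_family_def
proof (intro conjI ballI)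
  show "finite (restrict_family F H)" using family by (simp add: restrict_family_def box_family_def)
  show "restrict_family F H \<noteq> {}" using nonempty unfolding Union_restrict_family[symmetric] by auto
  show "disjoint (restrict_family F H)"
    using family unfolding restrict_family_def box_family_def pairwise_def disjnt_def by blast
  fix C assume "C \<in> restrict_family F H"
  then show "C \<noteq> {}" "\<exists>a b. C = box a b"
    using family cuts_boxes unfolding restrict_family_def box_family_def by fastforce+
qed

lemma card_restrict_family_le: "finite F \<Longrightarrow> card (restrict_family F H) \<le> card F"
  unfolding restrict_family_def
  by (meson Diff_subset card_image_le card_mono finite_imageI le_trans)

lemma card_restrict_family_less:
  assumes "finite F" "B \<in> F" "B \<inter> H = {}"
  shows "card (restrict_family F H) < card F"
proof -
  have "restrict_family F H \<subseteq> (\<lambda>B. B \<inter> H) ` (F - {B})"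
    using assms by (auto simp: restrict_family_def)
  then have "card (restrict_family F H) \<le> card (F - {B})"
    using assms(1) by (meson card_image_le card_mono finite_Diff finite_imageI le_trans)
  also have "\<dots> < card F" using assms by (intro card_Diff1_less)
  finally show ?thesis .
qed

lemma box_Int_halfspace_lt:
  assumes "i \<in> Basis"
  shows "\<exists>a' b'. box a b \<inter> {x. x \<bullet> i < c} = box a' (b'::'a::euclidean_space)"
proof (intro exI)
  show "box a b \<inter> {x. x \<bullet> i < c} = box a (b + (min (b \<bullet> i) c - b \<bullet> i) *\<^sub>R i)"
    using assms by (intro set_eqI) (auto simp: box_def inner_add_left inner_Basis)
qed

lemma box_Int_halfspace_gt:
  assumes "i \<in> Basis"
  shows "\<exists>a' b'. box a b \<inter> {x. c < x \<bullet> i} = box a' (b'::'a::euclidean_space)"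
proof (intro exI)
  show "box a b \<inter> {x. c < x \<bullet> i} = box (a + (max (a \<bullet> i) c - a \<bullet> i) *\<^sub>R i) b"
    using assms by (intro set_eqI) (auto simp: box_def inner_add_left inner_Basis)
qed

lemma box_family_restrict_halfspace:
  assumes family: "box_family F" and basis: "i \<in> Basis"
  shows "\<Union>F \<inter> {x. x \<bullet> i < c} \<noteq> {} \<Longrightarrow> box_family (restrict_family F {x. x \<bullet> i < c})"
    and "\<Union>F \<inter> {x. c < x \<bullet> i} \<noteq> {} \<Longrightarrow> box_family (restrict_family F {x. c < x \<bullet> i})"
  using box_family_restrict_family[OF family box_Int_halfspace_lt[OF basis]]
    box_family_restrict_family[OF family box_Int_halfspace_gt[OF basis]] by blast+

lemma disjoint_boxes_separated:
  fixes a b c d :: "'a::euclidean_space"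
  assumes "box a b \<noteq> {}" "box c d \<noteq> {}" "box a b \<inter> box c d = {}"
  shows "\<exists>i\<in>Basis. b \<bullet> i \<le> c \<bullet> i \<or> d \<bullet> i \<le> a \<bullet> i"
proof (rule ccontr)
  assume not_separated: "\<not> ?thesis"
  define x where "x = (\<Sum>i\<in>Basis. ((max (a \<bullet> i) (c \<bullet> i) + min (b \<bullet> i) (d \<bullet> i)) / 2) *\<^sub>R i)"
  have "max (a \<bullet> i) (c \<bullet> i) < min (b \<bullet> i) (d \<bullet> i)" if "i \<in> Basis" for i
    using not_separated assms that by (force simp: box_ne_empty)
  then have "x \<in> box a b \<inter> box c d" by (fastforce simp: x_def mem_box)
  with assms show False by simp
qed

lemma box_family_separating_hyperplane:
  fixes F :: "'a::euclidean_space set set"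
  assumes family: "box_family F" "2 \<le> card F"
  obtains i c B C where "i \<in> Basis" "B \<in> F" "C \<in> F"
    "B \<inter> {x. c < x \<bullet> i} = {}" "C \<inter> {x. x \<bullet> i < c} = {}"
proof -
  obtain B C where distinct_boxes: "B \<in> F" "C \<in> F" "B \<noteq> C"
    using family by (metis card_le_Suc0_iff_eq box_family_def not_less_eq_eq numeral_2_eq_2)
  obtain a b where B_box: "B = box a b"
    using family(1) distinct_boxes(1) unfolding box_family_def by blast
  obtain a' b' where C_box: "C = box a' b'"
    using family(1) distinct_boxes(2) unfolding box_family_def by blast
  have "B \<inter> C = {}" "B \<noteq> {}" "C \<noteq> {}"
    using family distinct_boxes by (auto simp: box_family_def pairwise_def disjnt_def)
  then obtain i where "i \<in> Basis" and "b \<bullet> i \<le> a' \<bullet> i \<or> b' \<bullet> i \<le> a \<bullet> i"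
    using disjoint_boxes_separated unfolding B_box C_box by blast
  then consider "b \<bullet> i \<le> a' \<bullet> i" | "b' \<bullet> i \<le> a \<bullet> i" by blast
  then show ?thesis
  proof cases
    case 1
    then have "B \<inter> {x. a' \<bullet> i < x \<bullet> i} = {}" "C \<inter> {x. x \<bullet> i < a' \<bullet> i} = {}"
      using \<open>i \<in> Basis\<close> by (force simp: B_box C_box box_def)+
    then show ?thesis using that distinct_boxes \<open>i \<in> Basis\<close> by blast
  next
    case 2
    then have "C \<inter> {x. a \<bullet> i < x \<bullet> i} = {}" "B \<inter> {x. x \<bullet> i < a \<bullet> i} = {}"
      using \<open>i \<in> Basis\<close> by (force simp: B_box C_box box_def)+
    then show ?thesis using that distinct_boxes \<open>i \<in> Basis\<close> by blast
  qed
qed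

lemma measure_box_family_pos:
  assumes "box_family F"
  shows "0 < measure lebesgue (\<Union>F)"
  using box_family_Union[OF assms] by (rule measure_open_pos)

lemma open_Int_halfspaces_nonempty:
  fixes S :: "'a::euclidean_space set"
  assumes "open S" "S \<noteq> {}" "i \<in> Basis"
  shows "S \<inter> {x. x \<bullet> i < c} \<noteq> {} \<or> S \<inter> {x. c < x \<bullet> i} \<noteq> {}"
proof (rule ccontr)
  assume "\<not> ?thesis"
  then have "S \<subseteq> {x. x \<bullet> i = c}" by force
  then have "negligible S" using assms(3) negligible_standard_hyperplane negligible_subset by blast
  then show False using open_not_negligible[OF assms(1,2)] by blast
qed

lemma box_family_bisection:
  fixes F :: "'a::euclidean_space set set"
  assumes family: "box_family F" "2 \<le> card F"
  obtains i c where "i \<in> Basis"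
    "box_family (restrict_family F {x. x \<bullet> i < c})"
    "card (restrict_family F {x. x \<bullet> i < c}) < card F"
    "box_family (restrict_family F {x. c < x \<bullet> i})"
    "card (restrict_family F {x. c < x \<bullet> i}) < card F"
proof -
  obtain i c B C where basis: "i \<in> Basis" and B_below: "B \<in> F" "B \<inter> {x. c < x \<bullet> i} = {}"
    and C_above: "C \<in> F" "C \<inter> {x. x \<bullet> i < c} = {}"
    using box_family_separating_hyperplane[OF family] by metis
  have "finite F" using family(1) by (simp add: box_family_def)
  have member: "open D" "D \<noteq> {}" if "D \<in> F" for D
    using family(1) that unfolding box_family_def by (metis open_box)+
  have "\<Union>F \<inter> {x. x \<bullet> i < c} \<noteq> {}" "\<Union>F \<inter> {x. c < x \<bullet> i} \<noteq> {}"
    using open_Int_halfspaces_nonempty[OF member[OF B_below(1)] basis, of c]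
      open_Int_halfspaces_nonempty[OF member[OF C_above(1)] basis, of c] B_below C_above by blast+
  then have "box_family (restrict_family F {x. x \<bullet> i < c})"
      "box_family (restrict_family F {x. c < x \<bullet> i})"
    using box_family_restrict_halfspace[OF family(1) basis] by blast+
  with that basis B_below C_above \<open>finite F\<close> card_restrict_family_less show ?thesis by metis
qed

lemma brunn_minkowski_box_family_cut:
  fixes F G :: "'a::euclidean_space set set"
  assumes family_F: "box_family F" "2 \<le> card F" and family_G: "box_family G"
    and fewer: "\<And>F' G' :: 'a set set. box_family F' \<Longrightarrow> box_family G' \<Longrightarrow>
      card F' + card G' < card F + card G \<Longrightarrow> brunn_minkowski (\<Union>F') (\<Union>G')"
  shows "brunn_minkowski (\<Union>F) (\<Union>G)"
proof -
  note Union_F = box_family_Union[OF family_F(1)] and Union_G = box_family_Union[OF family_G]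
  obtain i c where basis: "i \<in> Basis"
    and lower_F: "box_family (restrict_family F {x. x \<bullet> i < c})"
      "card (restrict_family F {x. x \<bullet> i < c}) < card F"
    and upper_F: "box_family (restrict_family F {x. c < x \<bullet> i})"
      "card (restrict_family F {x. c < x \<bullet> i}) < card F"
    using box_family_bisection[OF family_F] by blast
  note split = measure_split_hyperplane[OF lmeasurable_open basis]
  define l where "l = measure lebesgue (\<Union>F \<inter> {x. x \<bullet> i < c}) / measure lebesgue (\<Union>F)"
  have ratio: "0 < l" "l < 1"
    and cut_F: "measure lebesgue (\<Union>F \<inter> {x. x \<bullet> i < c}) = l * measure lebesgue (\<Union>F)"
    using measure_box_family_pos[OF lower_F(1)] measure_box_family_pos[OF upper_F(1)]
      split[OF Union_F(2,1), of c]
    by (auto simp: l_def Union_restrict_family field_simps)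
  obtain d where cut_G: "measure lebesgue (\<Union>G \<inter> {x. x \<bullet> i < d}) = l * measure lebesgue (\<Union>G)"
    using hyperplane_cut_exists[OF lmeasurable_open[OF Union_G(2,1)]
        measure_box_family_pos[OF family_G] basis ratio]
    by blast
  have "0 < l * measure lebesgue (\<Union>G)" "0 < (1 - l) * measure lebesgue (\<Union>G)"
    using ratio measure_box_family_pos[OF family_G] by simp_all
  then have "0 < measure lebesgue (\<Union>G \<inter> {x. x \<bullet> i < d})"
      "0 < measure lebesgue (\<Union>G \<inter> {x. d < x \<bullet> i})"
    using cut_G split[OF Union_G(2,1), of d] unfolding left_diff_distrib by linarith+
  then have "\<Union>G \<inter> {x. x \<bullet> i < d} \<noteq> {}" "\<Union>G \<inter> {x. d < x \<bullet> i} \<noteq> {}"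
    using measure_empty less_irrefl by metis+
  then have lower_G: "box_family (restrict_family G {x. x \<bullet> i < d})"
    and upper_G: "box_family (restrict_family G {x. d < x \<bullet> i})"
    using box_family_restrict_halfspace[OF family_G basis] by blast+
  have "finite G" using family_G by (simp add: box_family_def)
  then show ?thesis
    using brunn_minkowski_parallel_cuts[OF Union_F(1,2) Union_G(1,2) basis _ _ cut_F cut_G] ratio
      fewer[OF lower_F(1) lower_G add_less_le_mono[OF lower_F(2) card_restrict_family_le]]
      fewer[OF upper_F(1) upper_G add_less_le_mono[OF upper_F(2) card_restrict_family_le]]
    by (simp add: Union_restrict_family)
qed

text \<open>Hadwiger and Ohmann's induction on the number of boxes: a hyperplane separating two boxes
  of one family, and a translate of it cutting the other family in the same volume ratio, reduce
  both halves to fewer boxes.\<close>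
lemma brunn_minkowski_box_family:
  assumes "box_family F" "box_family G"
  shows "brunn_minkowski (\<Union>F) (\<Union>G)"
  using assms
proof (induction "card F + card G" arbitrary: F G rule: less_induct)
  case less
  have "finite F" "F \<noteq> {}" "finite G" "G \<noteq> {}" using less.prems by (auto simp: box_family_def)
  then consider (cut_F) "2 \<le> card F" | (cut_G) "2 \<le> card G" | (boxes) "card F = 1" "card G = 1"
    using card_gt_0_iff[of F] card_gt_0_iff[of G] by linarith
  then show ?case
  proof cases
    case cut_F
    show ?thesis
      by (rule brunn_minkowski_box_family_cut[OF less.prems(1) cut_F less.prems(2) less.hyps])
  next
    case cut_G
    have "brunn_minkowski (\<Union>F') (\<Union>G')"
      if "box_family F'" "box_family G'" "card F' + card G' < card G + card F"
      for F' G' :: "'a set set"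
      using less.hyps[of F' G'] that by (simp only: add.commute)
    then have "brunn_minkowski (\<Union>G) (\<Union>F)"
      by (rule brunn_minkowski_box_family_cut[OF less.prems(2) cut_G less.prems(1)])
    then show ?thesis by (rule brunn_minkowski_commute[THEN iffD1])
  next
    case boxes
    then obtain B C where "F = {B}" "G = {C}" by (meson card_1_singletonE)
    then show ?thesis
      using less.prems by (auto simp: box_family_def intro: brunn_minkowski_box)
  qed
qed

subsection \<open>From boxes to compact sets\<close>

lemma open_nonoverlapping_cboxes:
  fixes S :: "'a::euclidean_space set"
  assumes open_S: "open S" "bounded S" "S \<noteq> {}"
  obtains D where "countable D" "\<Union>D = S" "pairwise (\<lambda>A B. interior A \<inter> interior B = {}) D"
    "\<And>K. K \<in> D \<Longrightarrow> interior K \<noteq> {} \<and> (\<exists>c d. K = cbox c d)"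
proof -
  obtain a where in_cbox: "S \<subseteq> cbox (-a) a" using open_S bounded_subset_cbox_symmetric by blast
  then have "interior S \<subseteq> interior (cbox (-a) a)" by (rule interior_mono)
  then have nonempty: "box (-a) a \<noteq> {}" using open_S by (auto simp: interior_open)
  have "gauge (\<lambda>x. if x \<in> S then S else UNIV)" using open_S by (auto simp: gauge_def)
  from covering_lemma[OF in_cbox nonempty this] obtain D where tiling: "countable D"
    "\<And>K. K \<in> D \<Longrightarrow> interior K \<noteq> {} \<and> (\<exists>c d. K = cbox c d)"
    "pairwise (\<lambda>A B. interior A \<inter> interior B = {}) D"
    and tagged: "\<And>K. K \<in> D \<Longrightarrow> \<exists>x\<in>S \<inter> K. K \<subseteq> (if x \<in> S then S else UNIV)"
    and covers: "S \<subseteq> \<Union>D"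
    by metis
  from tagged covers have "\<Union>D = S" by fastforce
  with tiling show ?thesis using that by blast
qed

lemma measure_Union_interiors:
  fixes D :: "'a::euclidean_space set set"
  assumes "finite D" "\<And>K. K \<in> D \<Longrightarrow> convex K" "\<And>K. K \<in> D \<Longrightarrow> K \<in> lmeasurable"
  shows "measure lebesgue (\<Union>(interior ` D)) = measure lebesgue (\<Union>D)"
proof (rule measure_negligible_symdiff)
  show "\<Union>D \<in> lmeasurable" using assms by (intro fmeasurable.finite_Union) auto
  have "negligible (\<Union>(frontier ` D))"
    using assms(1,2) negligible_convex_frontier by (intro negligible_Union) auto
  moreover have "(\<Union>D - \<Union>(interior ` D)) \<union> (\<Union>(interior ` D) - \<Union>D) \<subseteq> \<Union>(frontier ` D)"
    using interior_subset closure_subset unfolding frontier_def by fastforce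
  ultimately show "negligible ((\<Union>D - \<Union>(interior ` D)) \<union> (\<Union>(interior ` D) - \<Union>D))"
    by (rule negligible_subset)
qed

lemma box_family_interiors_cboxes:
  assumes "finite D" "D \<noteq> {}" and disjoint: "pairwise (\<lambda>A B. interior A \<inter> interior B = {}) D"
    and cboxes: "\<And>K. K \<in> D \<Longrightarrow> interior K \<noteq> {} \<and> (\<exists>c d. K = cbox c d)"
  shows "box_family (interior ` D)"
  unfolding box_family_def
proof (intro conjI ballI)
  show "finite (interior ` D)" "interior ` D \<noteq> {}" using assms(1,2) by auto
  show "disjoint (interior ` D)"
    using disjoint unfolding pairwise_image by (auto simp: pairwise_def disjnt_def)
  fix B assume "B \<in> interior ` D"
  then show "B \<noteq> {}" "\<exists>a b. B = box a b" using cboxes interior_cbox by blast+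
qed

lemma open_box_family_approx:
  fixes S :: "'a::euclidean_space set"
  assumes open_S: "open S" "bounded S" "S \<noteq> {}" and "0 < e"
  shows "\<exists>F. box_family F \<and> \<Union>F \<subseteq> S \<and> measure lebesgue S - e < measure lebesgue (\<Union>F)"
proof -
  obtain D where tiling: "countable D" "\<Union>D = S" "pairwise (\<lambda>A B. interior A \<inter> interior B = {}) D"
    and cboxes: "\<And>K. K \<in> D \<Longrightarrow> interior K \<noteq> {} \<and> (\<exists>c d. K = cbox c d)"
    using open_nonoverlapping_cboxes[OF open_S] by blast
  have meas_S: "S \<in> lmeasurable" using open_S by (intro lmeasurable_open)
  have members: "K \<in> lmeasurable" "convex K" if "K \<in> D" for K
    using cboxes[OF that] by auto
  define \<epsilon> where "\<epsilon> = min e (measure lebesgue S)"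
  have "0 < \<epsilon>" using \<open>0 < e\<close> measure_open_pos[OF open_S] by (simp add: \<epsilon>_def)
  moreover have "measure lebesgue (\<Union>D') \<le> measure lebesgue S" if "D' \<subseteq> D" "finite D'" for D'
    using that tiling(2) members(1) meas_S
    by (intro measure_mono_fmeasurable fmeasurableD fmeasurable.finite_Union) auto
  ultimately obtain D' where finite_subtiling: "D' \<subseteq> D" "finite D'"
      and approx: "measure lebesgue S - \<epsilon> < measure lebesgue (\<Union>D')"
    using measure_countable_Union_approachable[OF tiling(1) _ members(1)] unfolding tiling(2)
    by metis
  have "D' \<noteq> {}" using approx by (auto simp: \<epsilon>_def)
  then have "box_family (interior ` D')"
    using finite_subtiling tiling(3) cboxes
    by (intro box_family_interiors_cboxes) (auto intro: pairwise_subset)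
  moreover have "\<Union>(interior ` D') \<subseteq> S" using finite_subtiling(1) tiling(2) interior_subset by fast
  moreover have "measure lebesgue S - e < measure lebesgue (\<Union>(interior ` D'))"
  proof -
    have "measure lebesgue (\<Union>(interior ` D')) = measure lebesgue (\<Union>D')"
      using finite_subtiling members by (intro measure_Union_interiors) auto
    then show ?thesis using approx by (simp add: \<epsilon>_def)
  qed
  ultimately show ?thesis by blast
qed

lemma brunn_minkowski_open:
  fixes U V :: "'a::euclidean_space set"
  assumes open_U: "open U" "bounded U" "U \<noteq> {}" and open_V: "open V" "bounded V" "V \<noteq> {}"
  shows "brunn_minkowski U V"
  unfolding brunn_minkowski_def
proof (rule LIMSEQ_le_const2)
  define inner_root :: "'a set \<Rightarrow> nat \<Rightarrow> real" where
    "inner_root S m = root DIM('a) (max 0 (measure lebesgue S - 1 / Suc m))" for S m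
  have "inner_root S \<longlonglongrightarrow> root DIM('a) (max 0 (measure lebesgue S - 0))" for S
    unfolding inner_root_def by (intro tendsto_intros LIMSEQ_Suc[OF lim_1_over_n])
  then have "inner_root S \<longlonglongrightarrow> root_volume S" for S by (simp add: root_volume_def)
  then show "(\<lambda>m. inner_root U m + inner_root V m) \<longlonglongrightarrow> root_volume U + root_volume V"
    by (intro tendsto_add)
  have "inner_root U m + inner_root V m \<le> root_volume (U + V)" for m
  proof -
    have inner_family: "\<exists>F. box_family F \<and> \<Union>F \<subseteq> S \<and> inner_root S m \<le> root_volume (\<Union>F)"
      if open_S: "open S" "bounded S" "S \<noteq> {}" for S
    proof -
      have "\<exists>F. box_family F \<and> \<Union>F \<subseteq> S \<and> measure lebesgue S - 1 / Suc m < measure lebesgue (\<Union>F)"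
        by (rule open_box_family_approx[OF open_S]) simp
      then show ?thesis by (auto simp: inner_root_def root_volume_def)
    qed
    obtain F where inner_F: "box_family F" "\<Union>F \<subseteq> U" "inner_root U m \<le> root_volume (\<Union>F)"
      using inner_family[OF open_U] by blast
    obtain G where inner_G: "box_family G" "\<Union>G \<subseteq> V" "inner_root V m \<le> root_volume (\<Union>G)"
      using inner_family[OF open_V] by blast
    have "inner_root U m + inner_root V m \<le> root_volume (\<Union>F) + root_volume (\<Union>G)"
      using inner_F(3) inner_G(3) by (rule add_mono)
    also have "\<dots> \<le> root_volume (\<Union>F + \<Union>G)"
      using brunn_minkowski_box_family[OF inner_F(1) inner_G(1)] by (simp only: brunn_minkowski_def)
    also have "\<dots> \<le> root_volume (U + V)"
      using inner_F inner_G open_U open_V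
      by (intro root_volume_mono set_plus_mono2 lmeasurable_open_set_plus box_family_Union)
    finally show ?thesis .
  qed
  then show "\<exists>N. \<forall>m\<ge>N. inner_root U m + inner_root V m \<le> root_volume (U + V)" by blast
qed

lemma brunn_minkowski_plus_cball:
  fixes K L :: "'a::euclidean_space set"
  assumes compact_K: "compact K" "K \<noteq> {}" and compact_L: "compact L" "L \<noteq> {}" and "0 < e"
  shows "root_volume K + root_volume L \<le> root_volume (K + L + cball 0 (2 * e))"
proof -
  define U where "U X = X + ball 0 e" for X :: "'a set"
  have open_U: "open (U X)" "bounded (U X)" and subset_U: "X \<subseteq> U X" if "compact X" for X
  proof -
    show "open (U X)" unfolding U_def by (intro open_set_plus open_ball)
    show "bounded (U X)"
      unfolding U_def by (intro bounded_set_plus compact_imp_bounded that bounded_ball)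
    show "X \<subseteq> U X"
      unfolding U_def add.commute[of X] by (rule set_zero_plus2) (simp add: \<open>0 < e\<close>)
  qed
  have "root_volume K + root_volume L \<le> root_volume (U K) + root_volume (U L)"
    by (intro add_mono root_volume_mono lmeasurable_compact lmeasurable_open open_U subset_U
        compact_K(1) compact_L(1))
  also have "\<dots> \<le> root_volume (U K + U L)"
    using brunn_minkowski_open[of "U K" "U L"] open_U subset_U compact_K compact_L
    unfolding brunn_minkowski_def by blast
  also have "\<dots> \<le> root_volume (K + L + cball 0 (2 * e))"
  proof (rule root_volume_mono)
    have "U K + U L = K + L + (ball 0 e + ball 0 e)" by (simp only: U_def add_ac)
    also have "\<dots> \<subseteq> K + L + (cball 0 e + cball 0 e)"
      by (intro set_plus_mono2 subset_refl ball_subset_cball)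
    also have "\<dots> \<subseteq> K + L + cball 0 (e + e)"
      by (intro set_plus_mono2 subset_refl cball_0_plus_cball_0)
    finally show "U K + U L \<subseteq> K + L + cball 0 (2 * e)" by (simp only: mult_2)
    show "U K + U L \<in> lmeasurable"
      using open_U compact_K(1) compact_L(1) by (intro lmeasurable_open_set_plus)
    show "K + L + cball 0 (2 * e) \<in> lmeasurable"
      by (intro lmeasurable_compact compact_set_plus compact_cball compact_K compact_L)
  qed
  finally show ?thesis .
qed

theorem brunn_minkowski_compact:
  fixes K L :: "'a::euclidean_space set"
  assumes compact_K: "compact K" "K \<noteq> {}" and compact_L: "compact L" "L \<noteq> {}"
  shows "brunn_minkowski K L"
  unfolding brunn_minkowski_def
proof (rule LIMSEQ_le_const)
  have "(\<lambda>m. measure lebesgue (K + L + cball 0 (2 / Suc m))) \<longlonglongrightarrow> measure lebesgue (K + L)"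
    by (intro measure_plus_cball_tendsto compact_set_plus compact_K compact_L) simp
  then show "(\<lambda>m. root_volume (K + L + cball 0 (2 / Suc m))) \<longlonglongrightarrow> root_volume (K + L)"
    unfolding root_volume_def by (rule tendsto_real_root)
  show "\<exists>N. \<forall>m\<ge>N. root_volume K + root_volume L \<le> root_volume (K + L + cball 0 (2 / Suc m))"
    using brunn_minkowski_plus_cball[OF compact_K compact_L, of "1 / Suc m" for m] by simp
qed

section \<open>Minkowski combinations\<close>

lemma scaleR_image_add:
  fixes S :: "'a::real_vector set"
  assumes "convex S" "0 \<le> a" "0 \<le> b"
  shows "(*\<^sub>R) (a + b) ` S = (*\<^sub>R) a ` S + (*\<^sub>R) b ` S"
proof
  show "(*\<^sub>R) (a + b) ` S \<subseteq> (*\<^sub>R) a ` S + (*\<^sub>R) b ` S"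
    by (auto simp: scaleR_add_left)
  show "(*\<^sub>R) a ` S + (*\<^sub>R) b ` S \<subseteq> (*\<^sub>R) (a + b) ` S"
  proof
    fix z assume "z \<in> (*\<^sub>R) a ` S + (*\<^sub>R) b ` S"
    then obtain x y where decomposition: "x \<in> S" "y \<in> S" "z = a *\<^sub>R x + b *\<^sub>R y"
      by (auto elim!: set_plus_elim)
    show "z \<in> (*\<^sub>R) (a + b) ` S"
    proof (cases "a + b = 0")
      case True
      then have "a = 0" "b = 0" using assms by auto
      then show ?thesis using decomposition by auto
    next
      case False
      then have "(a / (a + b)) *\<^sub>R x + (b / (a + b)) *\<^sub>R y \<in> S"
        using assms decomposition by (intro convexD) (auto simp: add_divide_distrib[symmetric])
      moreover have "z = (a + b) *\<^sub>R ((a / (a + b)) *\<^sub>R x + (b / (a + b)) *\<^sub>R y)"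
        using False decomposition by (simp add: scaleR_add_right)
      ultimately show ?thesis by blast
    qed
  qed
qed

definition minkowski_comb :: "('j::finite \<Rightarrow> real) \<Rightarrow> ('j \<Rightarrow> 'a::real_vector set) \<Rightarrow> 'a set" where
  "minkowski_comb a K = (\<Sum>j\<in>UNIV. (*\<^sub>R) (a j) ` K j)"

lemma compact_minkowski_comb:
  fixes K :: "'j::finite \<Rightarrow> 'a::real_normed_vector set"
  shows "(\<And>j. compact (K j)) \<Longrightarrow> compact (minkowski_comb a K)"
  unfolding minkowski_comb_def by (intro compact_set_sum compact_scaling)

lemma convex_minkowski_comb: "(\<And>j. convex (K j)) \<Longrightarrow> convex (minkowski_comb a K)"
  unfolding minkowski_comb_def by (intro convex_set_sum convex_scaling)

lemma minkowski_comb_alt: "minkowski_comb a K = {\<Sum>j\<in>UNIV. a j *\<^sub>R x j | x. \<forall>j. x j \<in> K j}"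
proof (intro set_eqI iffI)
  fix z assume "z \<in> minkowski_comb a K"
  then obtain s where z_eq: "z = sum s UNIV" and "\<forall>j. s j \<in> (*\<^sub>R) (a j) ` K j"
    by (auto simp: minkowski_comb_def set_sum_alt)
  then have "\<forall>j. \<exists>x. x \<in> K j \<and> s j = a j *\<^sub>R x" by (simp add: image_iff Bex_def)
  then obtain x where points: "\<forall>j. x j \<in> K j \<and> s j = a j *\<^sub>R x j"
    by (rule choice[elim_format]) blast
  then have "z = (\<Sum>j\<in>UNIV. a j *\<^sub>R x j)" by (simp add: z_eq)
  with points show "z \<in> {\<Sum>j\<in>UNIV. a j *\<^sub>R x j | x. \<forall>j. x j \<in> K j}" by blast
next
  fix z assume "z \<in> {\<Sum>j\<in>UNIV. a j *\<^sub>R x j | x. \<forall>j. x j \<in> K j}"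
  then show "z \<in> minkowski_comb a K"
    unfolding minkowski_comb_def set_sum_alt[OF finite] by blast
qed

lemma minkowski_comb_zero:
  assumes "\<And>j. K j \<noteq> {}"
  shows "minkowski_comb (\<lambda>_. 0) K = 0"
proof -
  have "(*\<^sub>R) 0 ` K j = 0" for j using assms by (simp add: image_constant_conv set_zero)
  then show ?thesis by (simp only: minkowski_comb_def sum.neutral_const)
qed

lemma minkowski_comb_add:
  assumes "\<And>j. convex (K j)" "\<And>j. 0 \<le> a j" "\<And>j. 0 \<le> b j"
  shows "minkowski_comb (\<lambda>j. a j + b j) K = minkowski_comb a K + minkowski_comb b K"
  unfolding minkowski_comb_def sum.distrib[symmetric] using assms
  by (intro sum.cong scaleR_image_add) auto

lemma minkowski_comb_sum:
  assumes bodies: "\<And>j. convex (K j)" "\<And>j. K j \<noteq> {}" and coeffs_nonneg: "\<And>k j. 0 \<le> c k j"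
    and "finite S"
  shows "(\<Sum>k\<in>S. minkowski_comb (c k) K) = minkowski_comb (\<lambda>j. \<Sum>k\<in>S. c k j) K"
  using \<open>finite S\<close>
proof (induction S rule: finite_induct)
  case empty
  then show ?case by (simp add: minkowski_comb_zero bodies(2))
next
  case (insert k S)
  then show ?case by (simp add: minkowski_comb_add bodies coeffs_nonneg sum_nonneg)
qed

lemma minkowski_comb_single:
  assumes "\<And>j. K j \<noteq> {}"
  shows "minkowski_comb (\<lambda>j. if j = i then x else 0) K = (*\<^sub>R) x ` K i"
proof -
  have "(*\<^sub>R) (if j = i then x else 0) ` K j = (if j = i then (*\<^sub>R) x ` K i else 0)" for j
    using assms by (simp add: image_constant_conv set_zero)
  then show ?thesis by (simp add: minkowski_comb_def)
qed

lemma outer_approximates_minkowski_comb: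
  assumes "\<And>j. outer_approximates (Y j) (K j)"
  shows "outer_approximates (\<lambda>m. minkowski_comb a (\<lambda>j. Y j m)) (minkowski_comb a K)"
  unfolding minkowski_comb_def using assms
  by (intro outer_approximates_sum outer_approximates_scaleR)

section \<open>Gradients of log-partition functions\<close>

definition partition_function :: "'a::real_inner set \<Rightarrow> 'a \<Rightarrow> real" where
  "partition_function P x = (\<Sum>v\<in>P. exp (x \<bullet> v))"

definition gibbs :: "'a::real_inner set \<Rightarrow> 'a \<Rightarrow> 'a \<Rightarrow> real" where
  "gibbs P x v = exp (x \<bullet> v) / partition_function P x"

definition gibbs_mean :: "'a::real_inner set \<Rightarrow> 'a \<Rightarrow> 'a" where
  "gibbs_mean P x = (\<Sum>v\<in>P. gibbs P x v *\<^sub>R v)"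

lemma partition_function_pos:
  assumes "finite P" "P \<noteq> {}"
  shows "0 < partition_function P x"
  unfolding partition_function_def using assms by (intro sum_pos) auto

lemma gibbs_pos:
  assumes "finite P" "P \<noteq> {}"
  shows "0 < gibbs P x v"
  unfolding gibbs_def using partition_function_pos[OF assms] by simp

lemma sum_gibbs:
  assumes "finite P" "P \<noteq> {}"
  shows "(\<Sum>v\<in>P. gibbs P x v) = 1"
  unfolding gibbs_def using partition_function_pos[OF assms, of x]
  by (simp add: sum_divide_distrib[symmetric] partition_function_def)

lemma gibbs_mean_in_hull:
  assumes "finite P" "P \<noteq> {}"
  shows "gibbs_mean P x \<in> convex hull P"
  unfolding gibbs_mean_def using assms
  by (intro convex_sum) (auto simp: sum_gibbs gibbs_pos less_imp_le hull_inc)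

lemma inner_le_ln_partition_function:
  assumes "finite P" "q \<in> convex hull P"
  shows "x \<bullet> q \<le> ln (partition_function P x)"
proof -
  have "x \<bullet> v \<le> ln (partition_function P x)" if "v \<in> P" for v
  proof -
    have "exp (x \<bullet> v) \<le> partition_function P x"
      unfolding partition_function_def using that assms by (intro member_le_sum) auto
    then show ?thesis using less_le_trans[OF exp_gt_zero] by (simp add: ln_ge_iff)
  qed
  then have "convex hull P \<subseteq> {q. x \<bullet> q \<le> ln (partition_function P x)}"
    by (intro hull_minimal) (auto simp: convex_halfspace_le)
  then show ?thesis using assms by auto
qed

lemma has_derivative_partition_function:
  assumes "finite P" "P \<noteq> {}"
  shows "(partition_function P has_derivative
    (\<lambda>h. partition_function P x * (gibbs_mean P x \<bullet> h))) (at x)"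
proof -
  have "(partition_function P has_derivative (\<lambda>h. \<Sum>v\<in>P. exp (x \<bullet> v) * (h \<bullet> v))) (at x)"
    unfolding partition_function_def by (auto intro!: derivative_eq_intros simp: mult.commute)
  moreover have "(\<Sum>v\<in>P. exp (x \<bullet> v) * (h \<bullet> v)) = partition_function P x * (gibbs_mean P x \<bullet> h)"
    for h
    using partition_function_pos[OF assms, of x]
    by (simp add: gibbs_mean_def gibbs_def inner_sum_right sum_distrib_left inner_commute)
  ultimately show ?thesis by simp
qed

lemma has_derivative_ln_partition_function:
  assumes "finite P" "P \<noteq> {}"
  shows "((\<lambda>x. ln (partition_function P x)) has_derivative (\<lambda>h. gibbs_mean P x \<bullet> h)) (at x)"
  using partition_function_pos[OF assms, of x]
  by (auto intro!: derivative_eq_intros has_derivative_partition_function[OF assms])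

lemma has_derivative_gibbs:
  assumes "finite P" "P \<noteq> {}"
  shows "((\<lambda>x. gibbs P x v) has_derivative (\<lambda>h. gibbs P x v * ((v - gibbs_mean P x) \<bullet> h))) (at x)"
proof -
  have gibbs_eq_exp: "exp (x \<bullet> v - ln (partition_function P x)) = gibbs P x v" for x
    using partition_function_pos[OF assms] by (simp add: gibbs_def exp_diff)
  have "((\<lambda>x. x \<bullet> v - ln (partition_function P x)) has_derivative
      (\<lambda>h. h \<bullet> v - gibbs_mean P x \<bullet> h)) (at x)"
    by (intro has_derivative_diff has_derivative_inner_left has_derivative_ident
      has_derivative_ln_partition_function[OF assms])
  from has_derivative_exp[OF this] show ?thesis
    unfolding gibbs_eq_exp by (simp add: inner_diff_left inner_commute[of _ v] mult.commute)
qed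

lemma has_derivative_gibbs_mean:
  assumes "finite P" "P \<noteq> {}"
  shows "(gibbs_mean P has_derivative
    (\<lambda>h. \<Sum>v\<in>P. (gibbs P x v * ((v - gibbs_mean P x) \<bullet> h)) *\<^sub>R (v - gibbs_mean P x))) (at x)"
proof -
  have "((\<lambda>x. \<Sum>v\<in>P. gibbs P x v *\<^sub>R v) has_derivative
    (\<lambda>h. \<Sum>v\<in>P. (gibbs P x v * ((v - gibbs_mean P x) \<bullet> h)) *\<^sub>R v)) (at x)"
    by (intro has_derivative_sum has_derivative_scaleR_left has_derivative_gibbs[OF assms])
  then have "(gibbs_mean P has_derivative
    (\<lambda>h. \<Sum>v\<in>P. (gibbs P x v * ((v - gibbs_mean P x) \<bullet> h)) *\<^sub>R v)) (at x)"
    by (simp only: gibbs_mean_def[symmetric])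
  moreover have "(\<Sum>v\<in>P. (gibbs P x v * ((v - gibbs_mean P x) \<bullet> h)) *\<^sub>R gibbs_mean P x) = 0" for h
  proof -
    have "(\<Sum>v\<in>P. gibbs P x v * ((v - gibbs_mean P x) \<bullet> h))
       = (\<Sum>v\<in>P. gibbs P x v * (v \<bullet> h)) - (\<Sum>v\<in>P. gibbs P x v) * (gibbs_mean P x \<bullet> h)"
      by (simp add: inner_diff_left right_diff_distrib sum_subtractf sum_distrib_right)
    also have "\<dots> = 0"
      by (simp add: sum_gibbs[OF assms] gibbs_mean_def inner_sum_left)
    finally show ?thesis by (simp add: scaleR_sum_left[symmetric])
  qed
  ultimately show ?thesis by (simp add: scaleR_right_diff_distrib sum_subtractf)
qed

lemma coercive_imp_critical_point:
  fixes f :: "'a::euclidean_space \<Rightarrow> real"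
  assumes der: "\<And>x. (f has_derivative f' x) (at x)" and coercive: "filterlim f at_top at_infinity"
  shows "\<exists>z. f' z = (\<lambda>h. 0)"
proof -
  have "\<forall>\<^sub>F x in at_infinity. f 0 \<le> f x" using coercive by (simp add: filterlim_at_top)
  then obtain R where outside: "0 < R" "\<And>x. R \<le> norm x \<Longrightarrow> f 0 \<le> f x"
    by (auto simp: eventually_at_infinity_pos)
  have "continuous_on (cball 0 R) f"
    using der by (meson continuous_at_imp_continuous_on has_derivative_continuous)
  then obtain z where minimum: "z \<in> cball 0 R" "\<And>x. x \<in> cball 0 R \<Longrightarrow> f z \<le> f x"
    using continuous_attains_inf[of "cball 0 R" f] outside(1) by auto
  have "f z \<le> f x" for x
  proof (cases "norm x \<le> R")
    case True
    then show ?thesis using minimum by (simp add: dist_norm)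
  next
    case False
    have "f z \<le> f 0" using minimum outside(1) by simp
    also have "\<dots> \<le> f x" using outside(2) False by simp
    finally show ?thesis .
  qed
  then show ?thesis using differential_zero_maxmin[OF _ open_UNIV der, of z] by blast
qed

lemma inj_if_derivative_pos:
  fixes f :: "'a::real_inner \<Rightarrow> 'a"
  assumes der: "\<And>x. (f has_derivative f' x) (at x)" and pos: "\<And>x h. h \<noteq> 0 \<Longrightarrow> 0 < f' x h \<bullet> h"
  shows "inj f"
proof (rule injI, rule ccontr)
  fix x y assume same_image: "f x = f y" and "x \<noteq> y"
  define h where "h = x - y"
  have "h \<noteq> 0" using \<open>x \<noteq> y\<close> by (simp add: h_def)
  define g where "g t = f (y + t *\<^sub>R h) \<bullet> h" for t :: real
  have deriv: "(g has_real_derivative (f' (y + t *\<^sub>R h) h \<bullet> h)) (at t)" for t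
  proof -
    have "(f \<circ> (\<lambda>t. y + t *\<^sub>R h) has_derivative f' (y + t *\<^sub>R h) \<circ> (\<lambda>s. s *\<^sub>R h)) (at t)"
      by (rule diff_chain_at) (auto intro!: derivative_eq_intros der)
    then have "(g has_derivative (\<lambda>s. f' (y + t *\<^sub>R h) (s *\<^sub>R h) \<bullet> h)) (at t)"
      unfolding g_def o_def by (rule has_derivative_inner_left)
    then show ?thesis
      unfolding has_field_derivative_def
      by (simp add: linear_scale[OF has_derivative_linear[OF der]] mult.commute[of _ "_ \<bullet> _"])
  qed
  have "g 0 < g 1"
  proof (rule DERIV_pos_imp_increasing[where f = g])
    show "\<exists>D. (g has_real_derivative D) (at t) \<and> 0 < D" for t
      using deriv pos[OF \<open>h \<noteq> 0\<close>] by blast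
  qed simp
  then show False using same_image by (simp add: g_def h_def)
qed

locale full_polytopes =
  fixes P :: "'j::finite \<Rightarrow> 'a::euclidean_space set"
  assumes finite_vertices: "\<And>j. finite (P j)"
    and interior_hull_nonempty: "\<And>j. interior (convex hull P j) \<noteq> {}"
begin

lemma vertices_nonempty: "P j \<noteq> {}"
  using interior_hull_nonempty[of j] by force

abbreviation body_comb :: "('j \<Rightarrow> real) \<Rightarrow> 'a set" where
  "body_comb a \<equiv> minkowski_comb a (\<lambda>j. convex hull P j)"

text \<open>The gradient of the convex function \<open>\<Sum>j\<in>UNIV. a j * ln (partition_function (P j) x)\<close>.\<close>
definition mean_map :: "('j \<Rightarrow> real) \<Rightarrow> 'a \<Rightarrow> 'a" where
  "mean_map a x = (\<Sum>j\<in>UNIV. a j *\<^sub>R gibbs_mean (P j) x)"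

definition mean_map_deriv :: "('j \<Rightarrow> real) \<Rightarrow> 'a \<Rightarrow> 'a \<Rightarrow> 'a" where
  "mean_map_deriv a x h = (\<Sum>j\<in>UNIV. a j *\<^sub>R (\<Sum>v\<in>P j.
     (gibbs (P j) x v * ((v - gibbs_mean (P j) x) \<bullet> h)) *\<^sub>R (v - gibbs_mean (P j) x)))"

lemma has_derivative_mean_map: "(mean_map a has_derivative mean_map_deriv a x) (at x)"
  unfolding mean_map_def[abs_def] mean_map_deriv_def[abs_def]
  by (intro has_derivative_sum has_derivative_scaleR_right has_derivative_gibbs_mean
    finite_vertices vertices_nonempty)

lemma gibbs_variance_pos:
  assumes "h \<noteq> 0"
  shows "0 < (\<Sum>v\<in>P j. gibbs (P j) x v * ((v - gibbs_mean (P j) x) \<bullet> h)\<^sup>2)"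
proof -
  have "\<exists>v\<in>P j. (v - gibbs_mean (P j) x) \<bullet> h \<noteq> 0"
  proof (rule ccontr)
    assume "\<not> ?thesis"
    then have "P j \<subseteq> {v. h \<bullet> v = h \<bullet> gibbs_mean (P j) x}"
      by (auto simp: inner_diff_right inner_commute)
    then have "convex hull P j \<subseteq> {v. h \<bullet> v = h \<bullet> gibbs_mean (P j) x}"
      by (intro hull_minimal) (auto simp: convex_hyperplane)
    then have "interior (convex hull P j) \<subseteq> {}"
      using interior_mono interior_hyperplane[OF assms] by metis
    then show False using interior_hull_nonempty by blast
  qed
  then obtain w where vertex: "w \<in> P j" "(w - gibbs_mean (P j) x) \<bullet> h \<noteq> 0" by blast
  note gibbs_pos = gibbs_pos[OF finite_vertices vertices_nonempty]
  show ?thesis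
    using vertex finite_vertices
    by (intro sum_pos2[of _ w])
      (auto intro!: mult_pos_pos mult_nonneg_nonneg gibbs_pos less_imp_le[OF gibbs_pos])
qed

lemma mean_map_deriv_pos:
  assumes "\<And>j. 0 \<le> a j" "\<exists>j. 0 < a j" and "h \<noteq> 0"
  shows "0 < mean_map_deriv a x h \<bullet> h"
proof -
  obtain i where positive: "0 < a i" using assms(2) by blast
  have "mean_map_deriv a x h \<bullet> h =
      (\<Sum>j\<in>UNIV. a j * (\<Sum>v\<in>P j. gibbs (P j) x v * ((v - gibbs_mean (P j) x) \<bullet> h)\<^sup>2))"
    by (simp add: mean_map_deriv_def inner_sum_left power2_eq_square mult.assoc)
  also have "0 < \<dots>"
    using positive assms(1) gibbs_variance_pos[OF \<open>h \<noteq> 0\<close>]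
    by (intro sum_pos2[of _ i] mult_pos_pos mult_nonneg_nonneg) (auto intro: less_imp_le)
  finally show ?thesis .
qed

lemma inj_mean_map:
  assumes "\<And>j. 0 \<le> a j" "\<exists>j. 0 < a j"
  shows "inj (mean_map a)"
  using has_derivative_mean_map mean_map_deriv_pos[OF assms] by (rule inj_if_derivative_pos)

lemma range_mean_map_subset: "range (mean_map a) \<subseteq> body_comb a"
proof (rule image_subsetI)
  fix x
  have "\<forall>j. gibbs_mean (P j) x \<in> convex hull P j"
    by (intro allI gibbs_mean_in_hull finite_vertices vertices_nonempty)
  then show "mean_map a x \<in> body_comb a"
    unfolding minkowski_comb_alt mean_map_def
    by (intro CollectI exI[of _ "\<lambda>j. gibbs_mean (P j) x"] conjI refl)
qed

lemma inner_le_sum_ln_partition_function: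
  assumes "\<And>j. 0 \<le> a j" and "q \<in> body_comb a"
  shows "x \<bullet> q \<le> (\<Sum>j\<in>UNIV. a j * ln (partition_function (P j) x))"
proof -
  obtain p where "\<And>j. p j \<in> convex hull P j" and q_eq: "q = (\<Sum>j\<in>UNIV. a j *\<^sub>R p j)"
    using assms(2) by (auto simp: minkowski_comb_alt)
  then have "x \<bullet> p j \<le> ln (partition_function (P j) x)" for j
    by (intro inner_le_ln_partition_function finite_vertices)
  then show ?thesis unfolding q_eq inner_sum_right inner_scaleR_right
    by (intro sum_mono mult_left_mono assms(1))
qed

lemma interior_subset_range_mean_map:
  assumes a_nonneg: "\<And>j. 0 \<le> a j"
  shows "interior (body_comb a) \<subseteq> range (mean_map a)"
proof
  fix y assume "y \<in> interior (body_comb a)"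
  then obtain d where ball_inside: "0 < d" "cball y d \<subseteq> body_comb a"
    by (auto simp: mem_interior_cball)
  define f where "f x = (\<Sum>j\<in>UNIV. a j * ln (partition_function (P j) x)) - x \<bullet> y" for x
  have der: "(f has_derivative (\<lambda>h. (mean_map a x - y) \<bullet> h)) (at x)" for x
  proof -
    have "(f has_derivative (\<lambda>h. (\<Sum>j\<in>UNIV. a j * (gibbs_mean (P j) x \<bullet> h)) - h \<bullet> y)) (at x)"
      unfolding f_def
      by (intro has_derivative_diff has_derivative_sum has_derivative_mult_right
        finite_vertices vertices_nonempty has_derivative_ln_partition_function
        has_derivative_inner_left has_derivative_ident)
    then show ?thesis
      by (rule has_derivative_eq_rhs)
        (simp add: mean_map_def inner_diff_right inner_sum_right inner_commute)
  qed
  have lower: "d * norm x \<le> f x" for x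
  proof (cases "x = 0")
    case True
    have "y \<in> body_comb a" using ball_inside by auto
    from inner_le_sum_ln_partition_function[OF a_nonneg this, of 0] show ?thesis
      by (simp add: True f_def)
  next
    case False
    have "y + (d / norm x) *\<^sub>R x \<in> body_comb a"
      using False ball_inside(1) by (intro subsetD[OF ball_inside(2)]) (simp add: dist_norm)
    from inner_le_sum_ln_partition_function[OF a_nonneg this, of x] show ?thesis
      using False
      by (simp add: f_def inner_add_right power2_norm_eq_inner[symmetric] power2_eq_square)
  qed
  have "filterlim (\<lambda>x. d * norm x) at_top at_infinity"
    by (intro filterlim_tendsto_pos_mult_at_top[OF tendsto_const ball_inside(1)]
        filterlim_norm_at_top)
  then have "filterlim f at_top at_infinity"
    by (rule filterlim_at_top_mono) (simp add: lower)
  then obtain z where "(\<lambda>h. (mean_map a z - y) \<bullet> h) = (\<lambda>h. 0)"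
    using coercive_imp_critical_point[OF der] by blast
  then have "mean_map a z = y" by (metis eq_iff_diff_eq_0 inner_eq_zero_iff)
  then show "y \<in> range (mean_map a)" by blast
qed

lemma compact_body_comb: "compact (body_comb a)"
  by (intro compact_minkowski_comb finite_imp_compact_convex_hull finite_vertices)

lemma negligible_symdiff_range_mean_map:
  assumes "\<And>j. 0 \<le> a j"
  shows "negligible (body_comb a - range (mean_map a) \<union> (range (mean_map a) - body_comb a))"
proof (rule negligible_subset)
  show "negligible (frontier (body_comb a))"
    by (intro negligible_convex_frontier convex_minkowski_comb convex_convex_hull)
  show "body_comb a - range (mean_map a) \<union> (range (mean_map a) - body_comb a)
      \<subseteq> frontier (body_comb a)"
    using range_mean_map_subset[of a] interior_subset_range_mean_map[of a] assms
      closure_subset[of "body_comb a"]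
    unfolding frontier_def by blast
qed

end

section \<open>Polynomiality of the volume\<close>

lemma sum_PiE_comp_permutes:
  assumes "p permutes (UNIV :: 'n set)"
  shows "(\<Sum>s\<in>UNIV \<rightarrow>\<^sub>E I. f (s \<circ> p)) = (\<Sum>s\<in>(UNIV :: 'n set) \<rightarrow>\<^sub>E I. f s)"
  by (rule sum.reindex_bij_witness[where i = "\<lambda>s. s \<circ> inv p" and j = "\<lambda>s. s \<circ> p"])
    (auto simp: PiE_iff fun_eq_iff permutes_inverses[OF assms])

lemma det_sum_rows:
  fixes b :: "'n::finite \<Rightarrow> 'i \<Rightarrow> 'c::comm_ring_1^'n"
  assumes "finite I"
  shows "det (\<chi> r. \<Sum>i\<in>I. b r i) = (\<Sum>s\<in>UNIV \<rightarrow>\<^sub>E I. det (\<chi> r. b r (s r)))"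
proof -
  have "det (\<chi> r. \<Sum>i\<in>I. b r i)
      = (\<Sum>p | p permutes UNIV. of_int (sign p) * (\<Prod>r\<in>UNIV. \<Sum>i\<in>I. b r i $ p r))"
    by (simp add: det_def sum_component)
  also have "\<dots>
      = (\<Sum>p | p permutes UNIV. \<Sum>s\<in>UNIV \<rightarrow>\<^sub>E I. of_int (sign p) * (\<Prod>r\<in>UNIV. b r (s r) $ p r))"
    using assms by (simp add: prod_sum_PiE sum_distrib_left)
  also have "\<dots>
      = (\<Sum>s\<in>UNIV \<rightarrow>\<^sub>E I. \<Sum>p | p permutes UNIV. of_int (sign p) * (\<Prod>r\<in>UNIV. b r (s r) $ p r))"
    by (rule sum.swap)
  finally show ?thesis by (simp add: det_def)
qed

lemma sum_permutes_diagonal_det: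
  fixes u :: "'n::finite \<Rightarrow> 'c::comm_ring_1^'n" and w :: "'n \<Rightarrow> 'c"
  shows "(\<Sum>p | p permutes UNIV. (\<Prod>k\<in>UNIV. w (p k) * u (p k) $ k) * det (\<chi> k. u (p k)))
    = (\<Prod>k\<in>UNIV. w k) * (det (\<chi> k. u k))\<^sup>2"
proof -
  have "(\<Prod>k\<in>UNIV. w (p k) * u (p k) $ k) * det (\<chi> k. u (p k))
      = (\<Prod>k\<in>UNIV. w k) * det (\<chi> k. u k) * (of_int (sign p) * (\<Prod>k\<in>UNIV. u (p k) $ k))"
    if permutation: "p permutes UNIV" for p
  proof -
    have "det (\<chi> k. u (p k)) = of_int (sign p) * det (\<chi> k. u k)"
      using det_permute_rows[OF permutation, of "\<chi> k. u k"] by simp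
    moreover have "(\<Prod>k\<in>UNIV. w (p k)) = (\<Prod>k\<in>UNIV. w k)"
      using prod.permute[OF permutation, of w] by (simp add: o_def)
    ultimately show ?thesis by (simp add: prod.distrib)
  qed
  then have "(\<Sum>p | p permutes UNIV. (\<Prod>k\<in>UNIV. w (p k) * u (p k) $ k) * det (\<chi> k. u (p k)))
      = (\<Prod>k\<in>UNIV. w k) * det (\<chi> k. u k)
        * (\<Sum>p | p permutes UNIV. of_int (sign p) * (\<Prod>k\<in>UNIV. u (p k) $ k))"
    by (simp add: sum_distrib_left)
  also have "(\<Sum>p | p permutes UNIV. of_int (sign p) * (\<Prod>k\<in>UNIV. u (p k) $ k)) = det (\<chi> k. u k)"
    by (subst det_transpose[symmetric]) (simp add: det_def transpose_def)
  finally show ?thesis by (simp add: power2_eq_square)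
qed

text \<open>The Cauchy-Binet formula for \<open>\<Sum>i. w i u\<^sub>i u\<^sub>i\<^sup>T\<close>, summed over all tuples
  instead of all subsets.\<close>
lemma det_gram_sum:
  fixes u :: "'i \<Rightarrow> 'c::{comm_ring_1,ring_char_0}^'n::finite" and w :: "'i \<Rightarrow> 'c"
  assumes "finite I"
  shows "fact CARD('n) * det (\<chi> r c. \<Sum>i\<in>I. w i * u i $ r * u i $ c)
    = (\<Sum>s\<in>(UNIV :: 'n set) \<rightarrow>\<^sub>E I. (\<Prod>k\<in>UNIV. w (s k)) * (det (\<chi> k. u (s k)))\<^sup>2)"
proof -
  define f where "f s = (\<Prod>k\<in>UNIV. w (s k) * u (s k) $ k) * det (\<chi> k. u (s k))" for s :: "'n \<Rightarrow> 'i"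
  have "det (\<chi> r c. \<Sum>i\<in>I. w i * u i $ r * u i $ c) = det (\<chi> r. \<Sum>i\<in>I. (w i * u i $ r) *s u i)"
    by (rule arg_cong[where f = det]) (simp add: vec_eq_iff)
  also have "\<dots> = (\<Sum>s\<in>UNIV \<rightarrow>\<^sub>E I. f s)"
    unfolding f_def det_sum_rows[OF assms] det_rows_mul by simp
  finally have det_eq: "det (\<chi> r c. \<Sum>i\<in>I. w i * u i $ r * u i $ c) = (\<Sum>s\<in>UNIV \<rightarrow>\<^sub>E I. f s)" .
  have "fact CARD('n) * (\<Sum>s\<in>UNIV \<rightarrow>\<^sub>E I. f s)
      = (\<Sum>p | p permutes (UNIV :: 'n set). \<Sum>s\<in>UNIV \<rightarrow>\<^sub>E I. f (s \<circ> p))"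
    by (simp add: sum_PiE_comp_permutes card_permutations[OF refl])
  also have "\<dots> = (\<Sum>s\<in>UNIV \<rightarrow>\<^sub>E I. \<Sum>p | p permutes UNIV. f (s \<circ> p))" by (rule sum.swap)
  also have "\<dots> = (\<Sum>s\<in>UNIV \<rightarrow>\<^sub>E I. (\<Prod>k\<in>UNIV. w (s k)) * (det (\<chi> k. u (s k)))\<^sup>2)"
    unfolding f_def o_def by (intro sum.cong refl sum_permutes_diagonal_det)
  finally show ?thesis by (simp only: det_eq)
qed

text \<open>The coefficient of \<open>\<Prod>k\<in>UNIV. a (t k)\<close> in the Jacobian determinant of \<open>mean_map a\<close>.\<close>
definition mixed_density :: "('j \<Rightarrow> (real^'n::finite) set) \<Rightarrow> ('n \<Rightarrow> 'j) \<Rightarrow> real^'n \<Rightarrow> real" where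
  "mixed_density P t x = (\<Sum>s\<in>PiE UNIV (\<lambda>k. P (t k)).
     (\<Prod>k\<in>UNIV. gibbs (P (t k)) x (s k)) * (det (\<chi> k. s k - gibbs_mean (P (t k)) x))\<^sup>2)
    / fact CARD('n)"

lemma mixed_density_permute:
  assumes permutation: "p permutes UNIV"
  shows "mixed_density P (t \<circ> p) x = mixed_density P t x"
proof -
  define f where "f t s
      = (\<Prod>k\<in>UNIV. gibbs (P (t k)) x (s k)) * (det (\<chi> k. s k - gibbs_mean (P (t k)) x))\<^sup>2"
    for t s
  have f_permute: "f (t \<circ> p) (s \<circ> p) = f t s" for s
  proof -
    have "det (\<chi> k. s (p k) - gibbs_mean (P (t (p k))) x)
        = of_int (sign p) * det (\<chi> k. s k - gibbs_mean (P (t k)) x)"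
      using det_permute_rows[OF permutation, of "\<chi> k. s k - gibbs_mean (P (t k)) x"] by simp
    moreover have "(of_int (sign p))\<^sup>2 = (1 :: real)" by (simp add: sign_def)
    moreover have "(\<Prod>k\<in>UNIV. gibbs (P (t (p k))) x (s (p k))) = (\<Prod>k\<in>UNIV. gibbs (P (t k)) x (s k))"
      using prod.permute[OF permutation, of "\<lambda>k. gibbs (P (t k)) x (s k)"] by (simp add: o_def)
    ultimately show ?thesis by (simp add: f_def power_mult_distrib)
  qed
  have "(\<Sum>s\<in>PiE UNIV (\<lambda>k. P (t k)). f t s) = (\<Sum>s\<in>PiE UNIV (\<lambda>k. P ((t \<circ> p) k)). f (t \<circ> p) s)"
  proof (rule sum.reindex_bij_witness[where i = "\<lambda>s. s \<circ> inv p" and j = "\<lambda>s. s \<circ> p"])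
    fix s assume "s \<in> PiE UNIV (\<lambda>k. P ((t \<circ> p) k))"
    then have "s (inv p k) \<in> P (t (p (inv p k)))" for k by (simp add: PiE_iff)
    then show "s \<circ> inv p \<in> PiE UNIV (\<lambda>k. P (t k))"
      by (simp add: PiE_iff permutes_inverses[OF permutation])
  qed (auto simp: PiE_iff fun_eq_iff permutes_inverses[OF permutation] f_permute)
  then show ?thesis by (simp add: mixed_density_def f_def)
qed

lemma continuous_on_det [continuous_intros]:
  fixes f :: "'a::topological_space \<Rightarrow> real^'n^'n::finite"
  assumes "continuous_on S f"
  shows "continuous_on S (\<lambda>x. det (f x))"
  unfolding det_def using assms by (intro continuous_intros)

locale full_cartesian_polytopes = full_polytopes P for P :: "'j::finite \<Rightarrow> (real^'n::finite) set"
begin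

lemma mixed_density_nonneg: "0 \<le> mixed_density P t x"
  unfolding mixed_density_def
  by (intro divide_nonneg_nonneg sum_nonneg mult_nonneg_nonneg prod_nonneg ballI
    less_imp_le[OF gibbs_pos] finite_vertices vertices_nonempty) auto

lemma continuous_on_mixed_density: "continuous_on S (mixed_density P t)"
proof -
  have "continuous_on S (\<lambda>x. gibbs (P j) x v)" for j v
    using has_derivative_gibbs[OF finite_vertices vertices_nonempty]
    by (meson continuous_at_imp_continuous_on has_derivative_continuous)
  moreover have "continuous_on S (gibbs_mean (P j))" for j
    using has_derivative_gibbs_mean[OF finite_vertices vertices_nonempty]
    by (meson continuous_at_imp_continuous_on has_derivative_continuous)
  ultimately show ?thesis unfolding mixed_density_def[abs_def]
    by (intro continuous_intros continuous_on_vec_lambda) auto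
qed

lemma matrix_mean_map_deriv:
  "matrix (mean_map_deriv a x) = (\<chi> r c. \<Sum>(j, v)\<in>Sigma UNIV P.
     a j * gibbs (P j) x v * (v - gibbs_mean (P j) x) $ r * (v - gibbs_mean (P j) x) $ c)"
proof -
  have "mean_map_deriv a x (axis c 1) $ r = (\<Sum>(j, v)\<in>Sigma UNIV P.
      a j * gibbs (P j) x v * (v - gibbs_mean (P j) x) $ r * (v - gibbs_mean (P j) x) $ c)" for r c
  proof -
    have "mean_map_deriv a x (axis c 1) $ r = (\<Sum>j\<in>UNIV. \<Sum>v\<in>P j.
        a j * gibbs (P j) x v * (v - gibbs_mean (P j) x) $ r * (v - gibbs_mean (P j) x) $ c)"
      by (simp add: mean_map_deriv_def sum_component sum_distrib_left inner_axis mult_ac)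
    also have "\<dots> = (\<Sum>(j, v)\<in>Sigma UNIV P.
        a j * gibbs (P j) x v * (v - gibbs_mean (P j) x) $ r * (v - gibbs_mean (P j) x) $ c)"
      using finite_vertices by (intro sum.Sigma) auto
    finally show ?thesis .
  qed
  then show ?thesis by (simp add: vec_eq_iff matrix_def)
qed

lemma det_mean_map_deriv:
  "det (matrix (mean_map_deriv a x)) = (\<Sum>t\<in>UNIV. (\<Prod>k\<in>UNIV. a (t k)) * mixed_density P t x)"
proof -
  define w where "w = (\<lambda>(j, v). a j * gibbs (P j) x v)"
  define u where "u = (\<lambda>(j, v). v - gibbs_mean (P j) x)"
  define f where "f t s
      = (\<Prod>k\<in>UNIV. gibbs (P (t k)) x (s k)) * (det (\<chi> k. s k - gibbs_mean (P (t k)) x))\<^sup>2"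
    for t :: "'n \<Rightarrow> 'j" and s :: "'n \<Rightarrow> real^'n"
  have mem_Sigma: "i \<in> Sigma UNIV P \<longleftrightarrow> snd i \<in> P (fst i)" for i by (cases i) simp
  have "matrix (mean_map_deriv a x) = (\<chi> r c. \<Sum>i\<in>Sigma UNIV P. w i * u i $ r * u i $ c)"
    unfolding matrix_mean_map_deriv w_def u_def by (simp add: case_prod_beta)
  then have "fact CARD('n) * det (matrix (mean_map_deriv a x)) =
      (\<Sum>s\<in>(UNIV :: 'n set) \<rightarrow>\<^sub>E Sigma UNIV P. (\<Prod>k\<in>UNIV. w (s k)) * (det (\<chi> k. u (s k)))\<^sup>2)"
    using finite_vertices by (simp add: det_gram_sum)
  also have "\<dots> = (\<Sum>(t, s)\<in>Sigma UNIV (\<lambda>t. PiE UNIV (\<lambda>k. P (t k))). (\<Prod>k\<in>UNIV. a (t k)) * f t s)"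
    by (rule sum.reindex_bij_witness[where j = "\<lambda>s. (fst \<circ> s, snd \<circ> s)"
      and i = "\<lambda>(t, s) k. (t k, s k)"])
      (auto simp: fun_eq_iff PiE_iff mem_Sigma case_prod_beta prod.distrib mult.assoc
        w_def u_def f_def)
  also have "\<dots> = (\<Sum>t\<in>UNIV. (\<Prod>k\<in>UNIV. a (t k)) * (\<Sum>s\<in>PiE UNIV (\<lambda>k. P (t k)). f t s))"
    unfolding sum_distrib_left
    by (intro sum.Sigma[symmetric] ballI finite_PiE finite_vertices finite)
  also have "\<dots> = fact CARD('n) * (\<Sum>t\<in>UNIV. (\<Prod>k\<in>UNIV. a (t k)) * mixed_density P t x)"
  proof -
    have "(\<Sum>s\<in>PiE UNIV (\<lambda>k. P (t k)). f t s) = fact CARD('n) * mixed_density P t x" for t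
      by (simp add: mixed_density_def f_def)
    then show ?thesis by (simp add: sum_distrib_left mult.left_commute)
  qed
  finally show ?thesis by simp
qed

lemma det_mean_map_deriv_nonneg:
  assumes "\<And>j. 0 \<le> a j"
  shows "0 \<le> det (matrix (mean_map_deriv a x))"
  unfolding det_mean_map_deriv
  by (intro sum_nonneg mult_nonneg_nonneg prod_nonneg mixed_density_nonneg assms)

end

definition volume_coefficients ::
    "('j::finite \<Rightarrow> (real^'n::finite) set) \<Rightarrow> (('n \<Rightarrow> 'j) \<Rightarrow> real) \<Rightarrow> bool" where
  "volume_coefficients K V \<longleftrightarrow>
     (\<forall>t. 0 \<le> V t) \<and> (\<forall>t p. p permutes UNIV \<longrightarrow> V (t \<circ> p) = V t) \<and>
     (\<forall>a. (\<forall>j. 0 \<le> a j) \<longrightarrow>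
        measure lebesgue (minkowski_comb a K) = (\<Sum>t\<in>UNIV. (\<Prod>k\<in>UNIV. a (t k)) * V t))"

context
  fixes P :: "'j::finite \<Rightarrow> (real^'n::{finite,wellorder}) set"
  assumes polytopes: "full_polytopes P"
begin

interpretation full_cartesian_polytopes P
  using polytopes by (simp add: full_cartesian_polytopes_def)

lemma volume_body_comb:
  assumes coeffs: "\<And>j. 0 \<le> a j" "\<exists>j. 0 < a j"
  shows "((\<lambda>x. det (matrix (mean_map_deriv a x))) has_integral measure lebesgue (body_comb a)) UNIV"
proof -
  have lmeasurable: "body_comb a \<in> lmeasurable" by (intro lmeasurable_compact compact_body_comb)
  note symdiff = negligible_symdiff_range_mean_map[of a, OF coeffs(1)]
  have range: "range (mean_map a) \<in> lmeasurable"
    "measure lebesgue (range (mean_map a)) = measure lebesgue (body_comb a)"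
    using lmeasurable_negligible_symdiff[OF lmeasurable symdiff]
      measure_negligible_symdiff[OF lmeasurable symdiff] .
  have abs: "\<bar>det (matrix (mean_map_deriv a x))\<bar> = det (matrix (mean_map_deriv a x))" for x
    using det_mean_map_deriv_nonneg[of a] coeffs(1) by simp
  have inj: "inj (mean_map a)" using coeffs by (rule inj_mean_map)
  have integrable: "(\<lambda>x. \<bar>det (matrix (mean_map_deriv a x))\<bar>) integrable_on UNIV"
    using measurable_differentiable_image_eq[OF _ has_derivative_mean_map inj] range(1) by simp
  then have "measure lebesgue (range (mean_map a))
      = integral UNIV (\<lambda>x. \<bar>det (matrix (mean_map_deriv a x))\<bar>)"
    using measure_differentiable_image_eq[OF _ has_derivative_mean_map inj] by simp
  with integrable show ?thesis by (simp add: abs range(2) has_integral_integrable_integral)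
qed

lemma mixed_density_integrable: "mixed_density P t integrable_on UNIV"
proof (rule measurable_bounded_by_integrable_imp_integrable)
  show "mixed_density P t \<in> borel_measurable (lebesgue_on UNIV)"
    by (intro continuous_imp_measurable_on_sets_lebesgue continuous_on_mixed_density) auto
  show "(\<lambda>x. det (matrix (mean_map_deriv (\<lambda>_. 1) x))) integrable_on UNIV"
    by (rule has_integral_integrable[OF volume_body_comb]) auto
  show "norm (mixed_density P t x) \<le> det (matrix (mean_map_deriv (\<lambda>_. 1) x))" for x
    using member_le_sum[of t UNIV "\<lambda>t. mixed_density P t x"]
    by (simp add: det_mean_map_deriv mixed_density_nonneg)
qed auto

lemma volume_coefficients_integral_mixed_density:
  "volume_coefficients (\<lambda>j. convex hull P j) (\<lambda>t. integral UNIV (mixed_density P t))"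
  unfolding volume_coefficients_def
proof (intro conjI allI impI)
  show "0 \<le> integral UNIV (mixed_density P t)" for t
    by (intro integral_nonneg mixed_density_integrable mixed_density_nonneg)
  show "integral UNIV (mixed_density P (t \<circ> p)) = integral UNIV (mixed_density P t)"
    if "p permutes UNIV" for t p
    by (intro arg_cong[where f = "integral UNIV"] ext mixed_density_permute that)
  fix a :: "'j \<Rightarrow> real" assume a_nonneg: "\<forall>j. 0 \<le> a j"
  show "measure lebesgue (body_comb a)
      = (\<Sum>t\<in>UNIV. (\<Prod>k\<in>UNIV. a (t k)) * integral UNIV (mixed_density P t))"
  proof (cases "\<exists>j. 0 < a j")
    case True
    have "measure lebesgue (body_comb a) = integral UNIV (\<lambda>x. det (matrix (mean_map_deriv a x)))"
      using volume_body_comb[of a] a_nonneg True by (simp add: integral_unique)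
    also have "\<dots> = (\<Sum>t\<in>UNIV. integral UNIV (\<lambda>x. (\<Prod>k\<in>UNIV. a (t k)) * mixed_density P t x))"
      unfolding det_mean_map_deriv
      by (intro integral_sum integrable_on_mult_right mixed_density_integrable) auto
    finally show ?thesis by simp
  next
    case False
    then have "a = (\<lambda>_. 0)" using a_nonneg by (auto simp: fun_eq_iff not_less intro: antisym)
    then show ?thesis
      using vertices_nonempty by (simp add: minkowski_comb_zero set_zero zero_power)
  qed
qed

end

section \<open>Arbitrary finite index types\<close>

text \<open>The library's change of variables theorem requires a well-ordered index type;
  \<open>'a ordered_copy\<close> supplies one for every finite type.\<close>

typedef 'a ordered_copy = "UNIV :: 'a set" morphisms of_copy to_copy ..

lemma bij_of_copy: "bij of_copy"
  by (metis UNIV_I bijI' of_copy_inject to_copy_inverse)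

instance ordered_copy :: (finite) finite
proof
  show "finite (UNIV :: 'a ordered_copy set)"
    using bij_betw_finite[of of_copy UNIV "UNIV :: 'a set"] bij_of_copy by auto
qed

instantiation ordered_copy :: (finite) wellorder
begin

definition less_eq_ordered_copy :: "'a ordered_copy \<Rightarrow> 'a ordered_copy \<Rightarrow> bool" where
  "x \<le> y \<longleftrightarrow> to_nat (of_copy x) \<le> to_nat (of_copy y)"

definition less_ordered_copy :: "'a ordered_copy \<Rightarrow> 'a ordered_copy \<Rightarrow> bool" where
  "x < y \<longleftrightarrow> to_nat (of_copy x) < to_nat (of_copy y)"

instance
proof
  fix Q :: "'a ordered_copy \<Rightarrow> bool" and a
  assume step: "\<And>x. (\<And>y. y < x \<Longrightarrow> Q y) \<Longrightarrow> Q x"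
  show "Q a"
  proof (induction a rule: measure_induct_rule[where f = "\<lambda>x. to_nat (of_copy x)"])
    case (less x)
    then show ?case by (rule step) (simp only: less_ordered_copy_def)
  qed
next
  fix x y z :: "'a ordered_copy"
  show "x < y \<longleftrightarrow> x \<le> y \<and> \<not> y \<le> x" "x \<le> x" "x \<le> y \<Longrightarrow> y \<le> z \<Longrightarrow> x \<le> z" "x \<le> y \<or> y \<le> x"
    unfolding less_eq_ordered_copy_def less_ordered_copy_def by linarith+
  show "x = y" if "x \<le> y" "y \<le> x"
    using that unfolding less_eq_ordered_copy_def by (metis antisym of_copy_inject to_nat_split)
qed

end

definition reindex :: "real^'n::finite \<Rightarrow> real^('n ordered_copy)" where
  "reindex x = (\<chi> k. x $ of_copy k)"

definition unindex :: "real^('n::finite ordered_copy) \<Rightarrow> real^'n" where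
  "unindex y = (\<chi> k. y $ to_copy k)"

lemma reindex_inverse [simp]: "unindex (reindex x) = x" "reindex (unindex y) = y"
  by (simp_all add: reindex_def unindex_def vec_eq_iff to_copy_inverse of_copy_inverse)

lemma bij_reindex: "bij reindex"
  by (rule o_bij[of unindex]) (simp_all add: fun_eq_iff)

lemma linear_reindex: "linear reindex"
  by (rule linearI) (simp_all add: reindex_def vec_eq_iff)

lemma continuous_on_reindex: "continuous_on S reindex"
  using linear_reindex by (intro linear_continuous_on linear_conv_bounded_linear[THEN iffD1])

lemma prod_Basis_vec: "(\<Prod>b\<in>Basis. x \<bullet> b) = (\<Prod>k\<in>UNIV. (x :: real^'n::finite) $ k)"
proof -
  have Basis: "(Basis :: (real^'n) set) = (\<lambda>k. axis k 1) ` UNIV" by (auto simp: Basis_vec_def)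
  have inj: "inj (\<lambda>k :: 'n. axis k (1::real))" by (auto simp: inj_def axis_eq_axis)
  show ?thesis unfolding Basis prod.reindex[OF inj] by (simp add: inner_axis)
qed

lemma vimage_reindex_box: "reindex -` box l u = box (unindex l) (unindex u)"
proof (intro set_eqI iffI)
  fix x assume "x \<in> reindex -` box l u"
  then have "l $ k < x $ of_copy k \<and> x $ of_copy k < u $ k" for k
    by (simp add: mem_box_cart reindex_def)
  from this[of "to_copy _"] show "x \<in> box (unindex l) (unindex u)"
    by (simp add: mem_box_cart unindex_def to_copy_inverse)
next
  fix x assume "x \<in> box (unindex l) (unindex u)"
  then have "l $ to_copy k < x $ k \<and> x $ k < u $ to_copy k" for k
    by (simp add: mem_box_cart unindex_def)
  from this[of "of_copy _"] show "x \<in> reindex -` box l u"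
    by (simp add: mem_box_cart reindex_def of_copy_inverse)
qed

lemma lborel_reindex: "lborel = distr lborel borel (reindex :: real^'n::finite \<Rightarrow> _)"
proof (rule lborel_eqI)
  have meas: "(reindex :: real^'n \<Rightarrow> _) \<in> borel_measurable borel"
    by (intro borel_measurable_continuous_onI continuous_on_reindex)
  fix l u :: "real^('n ordered_copy)" assume "\<And>b. b \<in> Basis \<Longrightarrow> l \<bullet> b \<le> u \<bullet> b"
  then have "l $ k \<le> u $ k" for k
    by (metis axis_in_Basis_iff cart_eq_inner_axis Basis_real_def insertI1)
  then have unindex_le: "unindex l \<bullet> b \<le> unindex u \<bullet> b" if "b \<in> Basis" for b
    using that by (auto simp: Basis_vec_def inner_axis unindex_def)
  have "emeasure (distr lborel borel reindex) (box l u)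
      = emeasure lborel (box (unindex l) (unindex u))"
    using meas by (simp add: emeasure_distr vimage_reindex_box)
  also have "\<dots> = ennreal (\<Prod>b\<in>Basis. (unindex u - unindex l) \<bullet> b)"
    using unindex_le by (simp add: emeasure_lborel_box)
  also have "(\<Prod>b\<in>Basis. (unindex u - unindex l) \<bullet> b) = (\<Prod>k\<in>UNIV. (u - l) $ to_copy k)"
    by (simp add: prod_Basis_vec unindex_def)
  also have "\<dots> = (\<Prod>k\<in>UNIV. (u - l) $ k)"
    by (rule prod.reindex_bij_witness[where i = of_copy and j = to_copy])
      (auto simp: to_copy_inverse of_copy_inverse)
  finally show "emeasure (distr lborel borel reindex) (box l u) = (\<Prod>b\<in>Basis. (u - l) \<bullet> b)"
    by (simp add: prod_Basis_vec)
qed simp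

lemma measure_reindex:
  fixes S :: "(real^'n::finite) set"
  assumes "compact S"
  shows "measure lebesgue (reindex ` S) = measure lebesgue S"
proof -
  have borel_S: "S \<in> sets borel" using assms by (simp add: borel_closed compact_imp_closed)
  have image: "reindex ` S \<in> sets borel"
    using compact_continuous_image[OF continuous_on_reindex assms]
    by (simp add: borel_closed compact_imp_closed)
  have meas: "(reindex :: real^'n \<Rightarrow> _) \<in> borel_measurable borel"
    by (intro borel_measurable_continuous_onI continuous_on_reindex)
  have "reindex -` (reindex ` S) = S" using bij_reindex by (intro inj_vimage_image_eq bij_is_inj)
  then have "measure (distr lborel borel reindex) (reindex ` S) = measure lborel S"
    using image meas by (simp add: measure_distr)
  then show ?thesis using borel_S image by (simp add: lborel_reindex[symmetric])
qed

lemma sum_prod_ordered_copy: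
  fixes g :: "('n::finite ordered_copy \<Rightarrow> 'j::finite) \<Rightarrow> real" and a :: "'j \<Rightarrow> real"
  shows "(\<Sum>t\<in>UNIV. (\<Prod>k\<in>UNIV. a (t k)) * g t)
    = (\<Sum>t\<in>UNIV. (\<Prod>k\<in>UNIV. a (t k)) * g (t \<circ> of_copy))"
proof (rule sum.reindex_bij_witness[where i = "\<lambda>t. t \<circ> of_copy" and j = "\<lambda>t. t \<circ> to_copy"])
  fix t :: "'n ordered_copy \<Rightarrow> 'j"
  have "(\<Prod>k\<in>UNIV. a ((t \<circ> to_copy) k)) = (\<Prod>k\<in>UNIV. a (t k))"
    by (rule prod.reindex_bij_witness[where i = of_copy and j = to_copy])
      (auto simp: to_copy_inverse of_copy_inverse)
  then show "(\<Prod>k\<in>UNIV. a ((t \<circ> to_copy) k)) * g (t \<circ> to_copy \<circ> of_copy) = (\<Prod>k\<in>UNIV. a (t k)) * g t"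
    by (simp add: o_def of_copy_inverse)
qed (auto simp: fun_eq_iff to_copy_inverse of_copy_inverse)

lemma minkowski_comb_linear_image:
  assumes "linear f"
  shows "f ` minkowski_comb a K = minkowski_comb a (\<lambda>j. f ` K j)"
proof (intro subset_antisym subsetI)
  fix z assume "z \<in> f ` minkowski_comb a K"
  then obtain x where "\<forall>j. x j \<in> K j" "z = (\<Sum>j\<in>UNIV. a j *\<^sub>R f (x j))"
    by (auto simp: minkowski_comb_alt linear_sum[OF assms] linear_scale[OF assms])
  then show "z \<in> minkowski_comb a (\<lambda>j. f ` K j)"
    unfolding minkowski_comb_alt by (intro CollectI exI[of _ "\<lambda>j. f (x j)"]) auto
next
  fix z assume "z \<in> minkowski_comb a (\<lambda>j. f ` K j)"
  then obtain y where "\<forall>j. \<exists>x\<in>K j. y j = f x" and z_eq: "z = (\<Sum>j\<in>UNIV. a j *\<^sub>R y j)"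
    by (auto simp: minkowski_comb_alt image_iff)
  then obtain x where preimages: "\<And>j. x j \<in> K j" "\<And>j. y j = f (x j)" by metis
  have "z = f (\<Sum>j\<in>UNIV. a j *\<^sub>R x j)"
    by (simp add: z_eq preimages(2) linear_sum[OF assms] linear_scale[OF assms])
  then show "z \<in> f ` minkowski_comb a K" using preimages(1) unfolding minkowski_comb_alt by blast
qed

lemma full_polytopes_linear_image:
  assumes "full_polytopes P" "linear f" "bij f"
  shows "full_polytopes (\<lambda>j. f ` P j)"
proof
  fix j
  show "finite (f ` P j)" using full_polytopes.finite_vertices[OF assms(1)] by simp
  show "interior (convex hull (f ` P j)) \<noteq> {}"
    unfolding convex_hull_linear_image[OF assms(2), symmetric]
      interior_bijective_linear_image[OF assms(2,3)]
    using full_polytopes.interior_hull_nonempty[OF assms(1)] by simp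
qed

lemma permutes_ordered_copy:
  assumes "p permutes (UNIV :: 'a set)"
  shows "to_copy \<circ> p \<circ> of_copy permutes UNIV"
proof -
  have "bij to_copy" by (metis UNIV_I bijI' of_copy_inverse to_copy_inject)
  then have "bij (to_copy \<circ> p \<circ> of_copy)" by (intro bij_comp permutes_bij[OF assms] bij_of_copy)
  then show ?thesis by (simp add: permutes_univ bij_iff)
qed

lemma volume_coefficients_polytopes:
  fixes P :: "'j::finite \<Rightarrow> (real^'n::finite) set"
  assumes polytopes: "full_polytopes P"
  shows "\<exists>V. volume_coefficients (\<lambda>j. convex hull P j) V"
proof -
  interpret full_polytopes P by fact
  obtain V where coeffs: "volume_coefficients (\<lambda>j. convex hull (reindex ` P j)) V"
    using volume_coefficients_integral_mixed_density
      full_polytopes_linear_image[OF polytopes linear_reindex bij_reindex] by blast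
  have "volume_coefficients (\<lambda>j. convex hull P j) (\<lambda>t. V (t \<circ> of_copy))"
    unfolding volume_coefficients_def
  proof (intro conjI allI impI)
    show "0 \<le> V (t \<circ> of_copy)" for t using coeffs by (simp add: volume_coefficients_def)
    show "V (t \<circ> p \<circ> of_copy) = V (t \<circ> of_copy)" if permutation: "p permutes UNIV" for t p
    proof -
      have "t \<circ> p \<circ> of_copy = t \<circ> of_copy \<circ> (to_copy \<circ> p \<circ> of_copy)"
        by (simp add: fun_eq_iff to_copy_inverse)
      then show ?thesis
        using coeffs permutes_ordered_copy[OF permutation] by (simp only: volume_coefficients_def)
    qed
    fix a :: "'j \<Rightarrow> real" assume a_nonneg: "\<forall>j. 0 \<le> a j"
    have "measure lebesgue (body_comb a) = measure lebesgue (reindex ` body_comb a)"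
      by (intro measure_reindex[symmetric] compact_body_comb)
    also have "reindex ` body_comb a = minkowski_comb a (\<lambda>j. convex hull (reindex ` P j))"
      by (simp only: minkowski_comb_linear_image[OF linear_reindex]
          convex_hull_linear_image[OF linear_reindex])
    finally show "measure lebesgue (body_comb a) = (\<Sum>t\<in>UNIV. (\<Prod>k\<in>UNIV. a (t k)) * V (t \<circ> of_copy))"
      using coeffs a_nonneg by (simp add: volume_coefficients_def sum_prod_ordered_copy)
  qed
  then show ?thesis by blast
qed

section \<open>Minkowski's theorem on mixed volumes\<close>

definition mixed_volume_fam :: "('n::finite \<Rightarrow> (real^'n) set) \<Rightarrow> real" where
  "mixed_volume_fam F = (1 / fact CARD('n)) *
     (\<Sum>S\<in>UNIV. (-1) ^ (CARD('n) - card S) * measure lebesgue (\<Sum>k\<in>S. F k))"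

lemma polarization:
  fixes V :: "('n::finite \<Rightarrow> 'j::finite) \<Rightarrow> 'c::{comm_ring_1,ring_char_0}" and c :: "'n \<Rightarrow> 'j \<Rightarrow> 'c"
  assumes symmetric: "\<And>t p. p permutes UNIV \<Longrightarrow> V (t \<circ> p) = V t"
  shows "(\<Sum>S\<in>UNIV. (-1) ^ (CARD('n) - card S) * (\<Sum>t\<in>UNIV. (\<Prod>i\<in>UNIV. \<Sum>k\<in>S. c k (t i)) * V t))
    = fact CARD('n) * (\<Sum>t\<in>UNIV. (\<Prod>k\<in>UNIV. c k (t k)) * V t)"
proof -
  define h where "h s = (\<Sum>t\<in>UNIV. (\<Prod>i\<in>UNIV. c (s i) (t i)) * V t)" for s :: "'n \<Rightarrow> 'n"
  define f where "f U = (\<Sum>s | range s = U. h s)" for U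
  define g where "g S = (\<Sum>t\<in>UNIV. (\<Prod>i\<in>UNIV. \<Sum>k\<in>S. c k (t i)) * V t)" for S
  have g_eq: "g S = sum f (Pow S)" if "finite S" for S
  proof -
    have "g S = (\<Sum>t\<in>UNIV. \<Sum>s\<in>UNIV \<rightarrow>\<^sub>E S. (\<Prod>i\<in>UNIV. c (s i) (t i)) * V t)"
      unfolding g_def by (simp add: prod_sum_PiE sum_distrib_right)
    also have "\<dots> = (\<Sum>s\<in>UNIV \<rightarrow>\<^sub>E S. h s)" unfolding h_def by (rule sum.swap)
    also have "\<dots> = (\<Sum>U\<in>Pow S. \<Sum>s\<in>{s \<in> UNIV \<rightarrow>\<^sub>E S. range s = U}. h s)"
      by (intro sum.group[symmetric] finite_PiE) auto
    also have "\<dots> = sum f (Pow S)" unfolding f_def by (intro sum.cong) auto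
    finally show ?thesis .
  qed
  have h_permutes: "h p = (\<Sum>t\<in>UNIV. (\<Prod>k\<in>UNIV. c k (t k)) * V t)"
    if permutation: "p permutes UNIV" for p
  proof -
    have "h p = (\<Sum>t\<in>UNIV. (\<Prod>i\<in>UNIV. c (p i) (t (p i))) * V (t \<circ> p))"
      using sum_PiE_comp_permutes[OF permutation, of "\<lambda>t. (\<Prod>i\<in>UNIV. c (p i) (t i)) * V t" UNIV]
      by (simp add: h_def o_def)
    moreover have "(\<Prod>i\<in>UNIV. c (p i) (t (p i))) = (\<Prod>k\<in>UNIV. c k (t k))" for t
      using prod.permute[OF permutation, of "\<lambda>k. c k (t k)"] by (simp add: o_def)
    ultimately show ?thesis by (simp only: symmetric[OF permutation])
  qed
  have surj_eq_permutes: "{s :: 'n \<Rightarrow> 'n. range s = UNIV} = {p. p permutes UNIV}"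
    using finite_UNIV_surj_inj[OF finite] by (auto simp: permutes_univ bij_def bij_iff[symmetric])
  have "(\<Sum>S\<in>UNIV. (-1) ^ (CARD('n) - card S) * g S) = f UNIV"
    using inclusion_exclusion_mobius[OF g_eq finite] by simp
  also have "\<dots> = fact CARD('n) * (\<Sum>t\<in>UNIV. (\<Prod>k\<in>UNIV. c k (t k)) * V t)"
    by (simp add: f_def surj_eq_permutes h_permutes card_permutations[OF refl])
  finally show ?thesis by (simp only: g_def)
qed

lemma mixed_volume_fam_minkowski_comb:
  assumes bodies: "\<And>j. convex_body (K j)" and coeffs: "volume_coefficients K V"
    and c_nonneg: "\<And>k j. 0 \<le> c k j"
  shows "mixed_volume_fam (\<lambda>k. minkowski_comb (c k) K) = (\<Sum>t\<in>UNIV. (\<Prod>k\<in>UNIV. c k (t k)) * V t)"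
proof -
  have "measure lebesgue (\<Sum>k\<in>S. minkowski_comb (c k) K)
      = (\<Sum>t\<in>UNIV. (\<Prod>i\<in>UNIV. \<Sum>k\<in>S. c k (t i)) * V t)" for S
  proof -
    have "(\<Sum>k\<in>S. minkowski_comb (c k) K) = minkowski_comb (\<lambda>j. \<Sum>k\<in>S. c k j) K"
      using bodies c_nonneg by (intro minkowski_comb_sum) (auto simp: convex_body_def)
    then show ?thesis using coeffs c_nonneg by (simp add: volume_coefficients_def sum_nonneg)
  qed
  then show ?thesis
    using coeffs polarization[of V c] by (simp add: mixed_volume_fam_def volume_coefficients_def)
qed

lemma volume_coefficients_eq:
  fixes K :: "'j::finite \<Rightarrow> (real^'n::finite) set"
  assumes bodies: "\<And>j. convex_body (K j)" and coeffs: "volume_coefficients K V"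
  shows "V t = mixed_volume_fam (K \<circ> t)"
proof -
  define c :: "'n \<Rightarrow> 'j \<Rightarrow> real" where "c k j = (if j = t k then 1 else 0)" for k j
  have "minkowski_comb (c k) K = (*\<^sub>R) 1 ` K (t k)" for k
    unfolding c_def[abs_def] using bodies
    by (intro minkowski_comb_single) (simp add: convex_body_def)
  then have "K \<circ> t = (\<lambda>k. minkowski_comb (c k) K)" by (simp add: fun_eq_iff)
  then have "mixed_volume_fam (K \<circ> t) = (\<Sum>s\<in>UNIV. (\<Prod>k\<in>UNIV. c k (s k)) * V s)"
    using mixed_volume_fam_minkowski_comb[OF bodies coeffs, of c] by (simp add: c_def)
  also have "\<dots> = (\<Sum>s\<in>UNIV. if s = t then V s else 0)"
    by (intro sum.cong) (auto simp: c_def fun_eq_iff)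
  finally show ?thesis by simp
qed

lemma ex_polytope_neighbourhood_0:
  fixes e :: real
  assumes "0 < e"
  obtains S :: "'a::euclidean_space set" and d where
    "0 < d" "finite S" "ball 0 d \<subseteq> convex hull S" "convex hull S \<subseteq> cball 0 e"
proof -
  define d where "d = e / DIM('a)"
  have d_pos: "0 < d" using assms by (simp add: d_def)
  define C where "C = cbox (- (\<Sum>i\<in>Basis. d *\<^sub>R i)) (\<Sum>i\<in>Basis. d *\<^sub>R i :: 'a)"
  have mem_C: "z \<in> C \<longleftrightarrow> (\<forall>i\<in>Basis. \<bar>z \<bullet> i\<bar> \<le> d)" for z
    by (auto simp: C_def mem_box abs_le_iff minus_le_iff)
  obtain S :: "'a set" where hull_S: "finite S" "C = convex hull S"
    using cube_convex_hull[OF d_pos, of 0] by (auto simp: C_def)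
  have "ball 0 d \<subseteq> C"
  proof
    fix z :: 'a assume "z \<in> ball 0 d"
    then show "z \<in> C" unfolding mem_C using Basis_le_norm[of _ z] by fastforce
  qed
  moreover have "C \<subseteq> cball 0 e"
  proof
    fix z assume "z \<in> C"
    then have "(\<Sum>i\<in>Basis. \<bar>z \<bullet> i\<bar>) \<le> (\<Sum>i\<in>(Basis :: 'a set). d)"
      by (intro sum_mono) (simp add: mem_C)
    then show "z \<in> cball 0 e" using norm_le_l1[of z] by (simp add: d_def)
  qed
  ultimately show ?thesis using that d_pos hull_S by blast
qed

lemma polytope_outer_approx:
  fixes K :: "'a::euclidean_space set"
  assumes body: "compact K" "convex K" "K \<noteq> {}" and "0 < e"
  shows "\<exists>P. finite P \<and> interior (convex hull P) \<noteq> {} \<and> K \<subseteq> convex hull P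
    \<and> convex hull P \<subseteq> K + cball 0 e"
proof -
  obtain S :: "'a set" and d where d_pos: "0 < d"
    and neighbourhood: "finite S" "ball 0 d \<subseteq> convex hull S" "convex hull S \<subseteq> cball 0 e"
    using ex_polytope_neighbourhood_0[where 'a = 'a, OF \<open>0 < e\<close>] .
  obtain N where net: "N \<subseteq> K" "finite N" "K \<subseteq> (\<Union>x\<in>N. ball x d)"
    by (rule compactE_image[OF body(1), of K "\<lambda>x. ball x d"]) (use d_pos in auto)
  have hull: "convex hull (N + S) = convex hull N + convex hull S" by (rule convex_hull_set_plus)
  have ball_subset: "ball y d \<subseteq> convex hull (N + S)" if "y \<in> N" for y
  proof
    fix x assume "x \<in> ball y d"
    then have "x - y \<in> convex hull S"
      using neighbourhood(2) by (auto simp: dist_norm norm_minus_commute)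
    then have "y + (x - y) \<in> convex hull N + convex hull S" using that
      by (intro set_plus_intro) (auto intro: hull_inc)
    then show "x \<in> convex hull (N + S)" by (simp add: hull)
  qed
  show ?thesis
  proof (intro exI conjI)
    show "finite (N + S)" using net neighbourhood by (simp add: finite_set_plus)
    show "K \<subseteq> convex hull (N + S)" using net(3) ball_subset by blast
    have "convex hull N \<subseteq> K" using net body by (intro hull_minimal)
    then show "convex hull (N + S) \<subseteq> K + cball 0 e"
      unfolding hull using neighbourhood(3) by (rule set_plus_mono2)
    obtain y where "y \<in> N" using net body by auto
    then have "ball y d \<subseteq> interior (convex hull (N + S))"
      by (intro interior_maximal ball_subset open_ball)
    then show "interior (convex hull (N + S)) \<noteq> {}" using d_pos by auto
  qed
qed

lemma convex_body_polytope_sequence: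
  assumes "convex_body K"
  shows "\<exists>P. outer_approximates (\<lambda>m. convex hull P m) K
    \<and> (\<forall>m. finite (P m) \<and> interior (convex hull P m) \<noteq> {})"
proof -
  have body: "compact K" "convex K" "K \<noteq> {}" using assms by (auto simp: convex_body_def)
  have "\<forall>m. \<exists>P. finite P \<and> interior (convex hull P) \<noteq> {} \<and> K \<subseteq> convex hull P
      \<and> convex hull P \<subseteq> K + cball 0 (1 / real (Suc m))"
    using polytope_outer_approx[OF body] by simp
  then obtain P where polytopes: "\<And>m. finite (P m)" "\<And>m. interior (convex hull P m) \<noteq> {}"
      "\<And>m. K \<subseteq> convex hull P m" "\<And>m. convex hull P m \<subseteq> K + cball 0 (1 / real (Suc m))"
    by metis
  then have "outer_approximates (\<lambda>m. convex hull P m) K"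
    by (intro outer_approximatesI[where r = 1] body finite_imp_compact_convex_hull) auto
  with polytopes(1,2) show ?thesis by blast
qed

lemma mixed_volume_fam_tendsto:
  assumes "\<And>k. outer_approximates (Y k) (F k)"
  shows "(\<lambda>m. mixed_volume_fam (\<lambda>k. Y k m)) \<longlonglongrightarrow> mixed_volume_fam F"
  unfolding mixed_volume_fam_def
  by (intro tendsto_mult tendsto_const tendsto_sum measure_outer_approximates_tendsto
    outer_approximates_sum assms)

lemma volume_coefficients_limit:
  fixes K :: "'j::finite \<Rightarrow> (real^'n::finite) set"
  assumes approx: "\<And>j. outer_approximates (Y j) (K j)"
    and coeffs: "\<And>m. volume_coefficients (\<lambda>j. Y j m) (V m)"
    and V_lim: "\<And>t. (\<lambda>m. V m t) \<longlonglongrightarrow> W t"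
  shows "volume_coefficients K W"
  unfolding volume_coefficients_def
proof (intro conjI allI impI)
  show "0 \<le> W t" for t
    using coeffs by (intro LIMSEQ_le_const[OF V_lim]) (auto simp: volume_coefficients_def)
  show "W (t \<circ> p) = W t" if "p permutes UNIV" for t p
    using V_lim[of "t \<circ> p"] V_lim[of t] coeffs that
    by (auto simp: volume_coefficients_def intro: LIMSEQ_unique)
  fix a :: "'j \<Rightarrow> real" assume "\<forall>j. 0 \<le> a j"
  then have "measure lebesgue (minkowski_comb a (\<lambda>j. Y j m))
      = (\<Sum>t\<in>UNIV. (\<Prod>k\<in>UNIV. a (t k)) * V m t)" for m
    using coeffs by (simp add: volume_coefficients_def)
  then have "(\<lambda>m. \<Sum>t\<in>UNIV. (\<Prod>k\<in>UNIV. a (t k)) * V m t) \<longlonglongrightarrow> measure lebesgue (minkowski_comb a K)"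
    using measure_outer_approximates_tendsto[OF
        outer_approximates_minkowski_comb[of Y K a, OF approx]]
    by simp
  moreover have "(\<lambda>m. \<Sum>t\<in>UNIV. (\<Prod>k\<in>UNIV. a (t k)) * V m t)
      \<longlonglongrightarrow> (\<Sum>t\<in>UNIV. (\<Prod>k\<in>UNIV. a (t k)) * W t)"
    by (intro tendsto_sum tendsto_mult tendsto_const V_lim)
  ultimately show "measure lebesgue (minkowski_comb a K) = (\<Sum>t\<in>UNIV. (\<Prod>k\<in>UNIV. a (t k)) * W t)"
    by (rule LIMSEQ_unique)
qed

theorem volume_coefficients_mixed_volume:
  fixes K :: "'j::finite \<Rightarrow> (real^'n::finite) set"
  assumes bodies: "\<And>j. convex_body (K j)"
  shows "volume_coefficients K (\<lambda>t. mixed_volume_fam (K \<circ> t))"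
proof -
  have "\<forall>j. \<exists>P. outer_approximates (\<lambda>m. convex hull P m) (K j)
      \<and> (\<forall>m. finite (P m) \<and> interior (convex hull P m) \<noteq> {})"
    using convex_body_polytope_sequence[OF bodies] by blast
  then obtain P where approx: "\<And>j. outer_approximates (\<lambda>m. convex hull P j m) (K j)"
      and full: "\<And>j m. finite (P j m)" "\<And>j m. interior (convex hull P j m) \<noteq> {}"
    by metis
  have body: "convex_body (convex hull P j m)" for j m
    using full(1) interior_subset[of "convex hull P j m"] full(2)[of j m]
    by (auto simp: convex_body_def finite_imp_compact_convex_hull)
  define V where "V m t = mixed_volume_fam (\<lambda>k. convex hull P (t k) m)" for m and t :: "'n \<Rightarrow> 'j"
  show ?thesis
  proof (rule volume_coefficients_limit[OF approx])
    fix m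
    have "full_polytopes (\<lambda>j. P j m)" using full by (simp add: full_polytopes_def)
    then obtain W where coeffs: "volume_coefficients (\<lambda>j. convex hull P j m) W"
      using volume_coefficients_polytopes by blast
    then have "W = V m"
      using volume_coefficients_eq[OF _ coeffs] body by (simp add: V_def fun_eq_iff o_def)
    with coeffs show "volume_coefficients (\<lambda>j. convex hull P j m) (V m)" by simp
    show "(\<lambda>m. V m t) \<longlonglongrightarrow> mixed_volume_fam (K \<circ> t)" for t
      unfolding V_def o_def by (intro mixed_volume_fam_tendsto approx)
  qed
qed

lemma mixed_volume_fam_nonneg:
  assumes "\<And>k. convex_body (F k)"
  shows "0 \<le> mixed_volume_fam F"
  using volume_coefficients_mixed_volume[of F] assms unfolding volume_coefficients_def
  by (metis comp_id)

text \<open>The coefficients that express the family \<open>F(i := x F i + y L)\<close> in the bodies \<open>F k\<close> (indexed by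
  \<open>Some k\<close>) and \<open>L\<close> (indexed by \<open>None\<close>).\<close>
definition update_coeff :: "'n \<Rightarrow> real \<Rightarrow> real \<Rightarrow> 'n \<Rightarrow> 'n option \<Rightarrow> real" where
  "update_coeff i x y k j =
     (if j = Some k then if k = i then x else 1 else 0)
       + (if j = None then if k = i then y else 0 else 0)"

lemma minkowski_comb_update_coeff:
  assumes "\<And>k. convex_body (F k)" "convex_body L" "0 \<le> x" "0 \<le> y"
  shows "minkowski_comb (update_coeff i x y k) (case_option L F)
      = (F(i := (*\<^sub>R) x ` F i + (*\<^sub>R) y ` L)) k"
proof -
  have bodies: "convex (case_option L F j)" "case_option L F j \<noteq> {}" for j
    using assms(1,2) by (auto simp: convex_body_def split: option.split)
  have "minkowski_comb (update_coeff i x y k) (case_option L F)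
      = (*\<^sub>R) (if k = i then x else 1) ` F k + (*\<^sub>R) (if k = i then y else 0) ` L"
    unfolding update_coeff_def[abs_def] using bodies assms(3,4)
    by (subst minkowski_comb_add) (simp_all add: minkowski_comb_single)
  then show ?thesis using assms(2) by (simp add: image_constant_conv convex_body_def)
qed

lemma prod_update_coeff_eq_0:
  fixes t :: "'n::finite \<Rightarrow> 'n option"
  assumes "t \<noteq> Some" "t \<noteq> Some(i := None)"
  shows "(\<Prod>k\<in>UNIV. update_coeff i x y k (t k)) = 0"
proof (rule ccontr)
  assume "(\<Prod>k\<in>UNIV. update_coeff i x y k (t k)) \<noteq> 0"
  then have nonzero: "update_coeff i x y k (t k) \<noteq> 0" for k by simp
  have alternatives: "t k = Some k \<or> k = i \<and> t k = None" for k
    using nonzero[of k] by (auto simp: update_coeff_def split: if_splits)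
  show False
  proof (cases "t i = None")
    case True
    then have "t k = (Some(i := None)) k" for k using alternatives[of k] by auto
    with assms(2) show False by blast
  next
    case False
    then have "t k = Some k" for k using alternatives[of k] by auto
    with assms(1) show False by blast
  qed
qed

lemma sum_prod_update_coeff:
  fixes W :: "('n::finite \<Rightarrow> 'n option) \<Rightarrow> real"
  shows "(\<Sum>t\<in>UNIV. (\<Prod>k\<in>UNIV. update_coeff i x y k (t k)) * W t)
      = x * W Some + y * W (Some(i := None))"
proof -
  have "(\<Sum>t\<in>UNIV. (\<Prod>k\<in>UNIV. update_coeff i x y k (t k)) * W t)
      = (\<Sum>t\<in>{Some, Some(i := None)}. (\<Prod>k\<in>UNIV. update_coeff i x y k (t k)) * W t)"
    by (intro sum.mono_neutral_right) (auto simp: prod_update_coeff_eq_0 simp del: prod_zero_iff)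
  moreover have "(\<Prod>k\<in>UNIV. update_coeff i x y k (Some k)) = x" by (simp add: update_coeff_def)
  moreover have "(\<Prod>k\<in>UNIV. update_coeff i x y k ((Some(i := None)) k))
      = (\<Prod>k\<in>UNIV. if k = i then y else 1)"
    by (intro prod.cong) (auto simp: update_coeff_def)
  moreover have "Some \<noteq> Some(i := None)" by (metis fun_upd_same option.distinct(1))
  ultimately show ?thesis by (simp del: fun_upd_apply)
qed

lemma mixed_volume_fam_linear:
  fixes F :: "'n::finite \<Rightarrow> (real^'n) set"
  assumes bodies: "\<And>k. convex_body (F k)" and body_L: "convex_body L" and nonneg: "0 \<le> x" "0 \<le> y"
  shows "mixed_volume_fam (F(i := (*\<^sub>R) x ` F i + (*\<^sub>R) y ` L))
    = x * mixed_volume_fam F + y * mixed_volume_fam (F(i := L))"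
proof -
  define B where "B = case_option L F"
  have body_B: "convex_body (B j)" for j
    using bodies body_L by (simp add: B_def split: option.split)
  have "F(i := (*\<^sub>R) x ` F i + (*\<^sub>R) y ` L) = (\<lambda>k. minkowski_comb (update_coeff i x y k) B)"
    unfolding B_def minkowski_comb_update_coeff[OF bodies body_L nonneg] ..
  moreover have "0 \<le> update_coeff i x y k j" for k j using nonneg by (simp add: update_coeff_def)
  ultimately have "mixed_volume_fam (F(i := (*\<^sub>R) x ` F i + (*\<^sub>R) y ` L))
      = x * mixed_volume_fam (B \<circ> Some) + y * mixed_volume_fam (B \<circ> Some(i := None))"
    using mixed_volume_fam_minkowski_comb[OF body_B volume_coefficients_mixed_volume[OF body_B],
        of "update_coeff i x y"]
    by (simp only: sum_prod_update_coeff)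
  moreover have "B \<circ> Some = F" "B \<circ> Some(i := None) = F(i := L)" by (auto simp: B_def fun_eq_iff)
  ultimately show ?thesis by simp
qed

section \<open>Mixed volumes of lists\<close>

lemma mixed_volume_eq_fam:
  fixes Ks :: "(real^'n::finite) set list"
  assumes enum: "bij_betw e (UNIV :: 'n set) {..<CARD('n)}"
  shows "mixed_volume Ks = mixed_volume_fam (\<lambda>k. Ks ! e k)"
proof -
  define f where "f S = (-1) ^ (CARD('n) - card S) * measure lebesgue (\<Sum>i\<in>S. Ks ! i)" for S
  have inj: "inj_on e S" for S using enum by (auto simp: bij_betw_def intro: inj_on_subset)
  have "(\<Sum>S\<in>{S. S \<subseteq> {..<CARD('n)} \<and> S \<noteq> {}}. f S) = (\<Sum>S\<in>Pow {..<CARD('n)}. f S)"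
    by (rule sum.mono_neutral_left) (auto simp: f_def set_zero)
  also have "\<dots> = (\<Sum>S\<in>Pow UNIV. f (e ` S))"
    using bij_betw_Pow[OF enum] by (rule sum.reindex_bij_betw[symmetric])
  also have "\<dots> = (\<Sum>S\<in>UNIV. (-1) ^ (CARD('n) - card S) * measure lebesgue (\<Sum>k\<in>S. Ks ! e k))"
    by (simp add: f_def card_image[OF inj] sum.reindex[OF inj])
  finally show ?thesis by (simp add: mixed_volume_def mixed_volume_fam_def f_def)
qed

lemma ex_enumeration: "\<exists>e. bij_betw e (UNIV :: 'n::finite set) {..<CARD('n)}"
  using ex_bij_betw_finite_nat[of "UNIV :: 'n set"] by (simp add: atLeast0LessThan)

lemma mixed_volume_mset_cong:
  fixes Ks Ls :: "(real^'n::finite) set list"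
  assumes "mset Ks = mset Ls" "length Ks = CARD('n)"
  shows "mixed_volume Ks = mixed_volume Ls"
proof -
  obtain e where enum: "bij_betw e (UNIV :: 'n set) {..<CARD('n)}" using ex_enumeration by blast
  have length: "length Ls = CARD('n)" using assms mset_eq_length by metis
  obtain p where permutation: "p permutes {..<CARD('n)}" "permute_list p Ls = Ks"
    using mset_eq_permutation[OF assms(1)] by (metis length)
  have "bij_betw (p \<circ> e) UNIV {..<CARD('n)}"
    using enum permutes_imp_bij[OF permutation(1)] by (rule bij_betw_trans)
  then have "mixed_volume Ls = mixed_volume_fam (\<lambda>k. Ls ! (p \<circ> e) k)" by (rule mixed_volume_eq_fam)
  also have "Ls ! (p \<circ> e) k = Ks ! e k" for k
    using permutation length bij_betwE[OF enum] by (auto simp: permute_list_nth)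
  then have "mixed_volume_fam (\<lambda>k. Ls ! (p \<circ> e) k) = mixed_volume Ks"
    by (simp only: mixed_volume_eq_fam[OF enum])
  finally show ?thesis by simp
qed

lemma mixed_volume_nonneg:
  fixes Ks :: "(real^'n::finite) set list"
  assumes "length Ks = CARD('n)" "\<And>K. K \<in> set Ks \<Longrightarrow> convex_body K"
  shows "0 \<le> mixed_volume Ks"
proof -
  obtain e where enum: "bij_betw e (UNIV :: 'n set) {..<CARD('n)}" using ex_enumeration by blast
  have "convex_body (Ks ! e k)" for k using assms bij_betwE[OF enum] by auto
  then show ?thesis unfolding mixed_volume_eq_fam[OF enum] by (rule mixed_volume_fam_nonneg)
qed

lemma mixed_volume_linear:
  fixes K L :: "(real^'n::finite) set"
  assumes body_K: "convex_body K" and body_L: "convex_body L" and nonneg: "0 \<le> x" "0 \<le> y"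
    and bodies_Ms: "Suc (length Ms) = CARD('n)" "\<And>M. M \<in> set Ms \<Longrightarrow> convex_body M"
  shows "mixed_volume (((*\<^sub>R) x ` K + (*\<^sub>R) y ` L) # Ms)
      = x * mixed_volume (K # Ms) + y * mixed_volume (L # Ms)"
proof -
  obtain e where enum: "bij_betw e (UNIV :: 'n set) {..<CARD('n)}" using ex_enumeration by blast
  then obtain i where first: "e i = 0"
    by (metis bij_betw_iff_bijections lessThan_iff zero_less_card_finite)
  define F where "F k = (K # Ms) ! e k" for k
  have "(M # Ms) ! e k = (F(i := M)) k" for M k
    using first bij_betw_imp_inj_on[OF enum]
    by (auto simp: F_def nth_Cons inj_on_def split: nat.split)
  then have mixed_volume_Cons: "mixed_volume (M # Ms) = mixed_volume_fam (F(i := M))" for M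
    by (simp only: mixed_volume_eq_fam[OF enum])
  have "convex_body (F k)" for k
  proof -
    have "(K # Ms) ! e k \<in> set (K # Ms)"
      using bij_betwE[OF enum] bodies_Ms(1) by (intro nth_mem) auto
    then show ?thesis using body_K bodies_Ms(2) by (auto simp: F_def)
  qed
  then have "mixed_volume_fam (F(i := (*\<^sub>R) x ` F i + (*\<^sub>R) y ` L))
      = x * mixed_volume_fam F + y * mixed_volume_fam (F(i := L))"
    using body_L nonneg by (rule mixed_volume_fam_linear)
  moreover have "F i = K" by (simp add: F_def first)
  ultimately show ?thesis unfolding mixed_volume_Cons by (metis fun_upd_triv)
qed

lemma mixed_volume_fam_two_bodies:
  fixes S :: "'n::finite set"
  shows "mixed_volume_fam (\<lambda>k. if k \<in> S then L else A)
    = mixed_volume (replicate (card S) L @ replicate (CARD('n) - card S) A)"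
proof -
  have card: "card S \<le> CARD('n)" "card (- S) = CARD('n) - card S"
    by (simp_all add: card_mono Compl_eq_Diff_UNIV card_Diff_subset)
  obtain f where enum_S: "bij_betw f S {..<card S}"
    using ex_bij_betw_finite_nat[of S] by (auto simp: atLeast0LessThan)
  obtain g where enum_compl: "bij_betw g (- S) {card S..<CARD('n)}"
    using finite_same_card_bij[of "- S" "{card S..<CARD('n)}"] card by auto
  define e where "e k = (if k \<in> S then f k else g k)" for k
  have "bij_betw e (S \<union> - S) ({..<card S} \<union> {card S..<CARD('n)})"
    using enum_S enum_compl unfolding e_def by (intro bij_betw_disjoint_Un) auto
  then have enum: "bij_betw e UNIV {..<CARD('n)}" using card(1) by (simp add: ivl_disj_un_one)
  have "(replicate (card S) L @ replicate (CARD('n) - card S) A) ! e k = (if k \<in> S then L else A)"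
    for k
    using bij_betwE[OF enum_S] bij_betwE[OF enum_compl] by (force simp: e_def nth_append)
  then show ?thesis by (simp only: mixed_volume_eq_fam[OF enum])
qed

lemma volume_steiner_polynomial:
  fixes A L :: "(real^'n::finite) set"
  assumes body_A: "convex_body A" and body_L: "convex_body L" and t_nonneg: "0 \<le> t"
  shows "measure lebesgue (A + (*\<^sub>R) t ` L) = (\<Sum>d\<le>CARD('n). real (CARD('n) choose d)
     * mixed_volume (replicate d L @ replicate (CARD('n) - d) A) * t ^ d)"
proof -
  define K where "K b = (if b then L else A)" for b
  define a where "a b = (if b then t else 1)" for b
  define V where "V d = mixed_volume (replicate d L @ replicate (CARD('n) - d) A)" for d
  have "convex_body (K b)" for b using body_A body_L by (simp add: K_def)
  then have "measure lebesgue (minkowski_comb a K)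
      = (\<Sum>s\<in>(UNIV :: ('n \<Rightarrow> bool) set). (\<Prod>k\<in>UNIV. a (s k)) * mixed_volume_fam (K \<circ> s))"
    using volume_coefficients_mixed_volume[of K] t_nonneg
    by (simp add: volume_coefficients_def a_def)
  also have "\<dots> = (\<Sum>S\<in>(UNIV :: 'n set set). V (card S) * t ^ card S)"
  proof (rule sum.reindex_bij_witness[where i = "\<lambda>S k. k \<in> S" and j = Collect])
    fix s :: "'n \<Rightarrow> bool"
    have "(\<Prod>k\<in>UNIV. a (s k)) = t ^ card {k. s k}" by (simp add: a_def prod.If_cases Collect_neg_eq)
    moreover have "mixed_volume_fam (K \<circ> s) = V (card {k. s k})"
      using mixed_volume_fam_two_bodies[of "{k. s k}" L A] by (simp add: K_def V_def o_def)
    ultimately show "V (card (Collect s)) * t ^ card (Collect s)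
        = (\<Prod>k\<in>UNIV. a (s k)) * mixed_volume_fam (K \<circ> s)"
      by simp
  qed auto
  also have "\<dots> = (\<Sum>d\<le>CARD('n). \<Sum>S\<in>{S\<in>(UNIV :: 'n set set). card S = d}. V (card S) * t ^ card S)"
    by (intro sum.group[symmetric]) (auto simp: card_mono)
  also have "\<dots> = (\<Sum>d\<le>CARD('n). real (CARD('n) choose d) * V d * t ^ d)"
    using n_subsets[of "UNIV :: 'n set"] by (intro sum.cong) (simp_all add: mult.assoc)
  also have "minkowski_comb a K = A + (*\<^sub>R) t ` L"
    by (simp add: minkowski_comb_def UNIV_bool a_def K_def add.commute)
  finally show ?thesis by (simp only: V_def)
qed

section \<open>Minkowski's quadratic inequality\<close>

lemma concave_below_tangent_at_0:
  fixes f :: "real \<Rightarrow> real"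
  assumes deriv: "(f has_real_derivative D) (at_right 0)" and t_pos: "0 < t"
    and chord: "\<And>s. 0 < s \<Longrightarrow> s < t \<Longrightarrow> (1 - s / t) * f 0 + s / t * f t \<le> f s"
  shows "f t \<le> f 0 + D * t"
proof -
  have "(f t - f 0) / t \<le> D"
  proof (rule tendsto_lowerbound)
    show "((\<lambda>s. (f s - f 0) / s) \<longlongrightarrow> D) (at_right 0)"
      using deriv by (simp add: has_field_derivative_iff)
    have "(f t - f 0) / t \<le> (f s - f 0) / s" if "0 < s" "s < t" for s
      using chord[OF that] that by (simp add: field_simps)
    then show "\<forall>\<^sub>F s in at_right 0. (f t - f 0) / t \<le> (f s - f 0) / s"
      unfolding eventually_at_right[OF t_pos] using t_pos by blast
  qed simp
  then show ?thesis using t_pos by (simp add: field_simps)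
qed

lemma coeff_2_nonneg:
  fixes p :: "real poly"
  assumes "coeff p 0 = 0" "coeff p 1 = 0" and nonneg: "\<And>t. 0 < t \<Longrightarrow> 0 \<le> poly p t"
  shows "0 \<le> coeff p 2"
proof -
  obtain a b q where p_eq: "p = pCons a (pCons b q)" by (metis pCons_cases)
  have "a = 0" "b = 0" using assms(1,2) by (simp_all add: p_eq)
  then have poly_p: "poly p t = t\<^sup>2 * poly q t" for t by (simp add: p_eq power2_eq_square)
  have "0 \<le> poly q 0"
  proof (rule tendsto_lowerbound)
    show "(poly q \<longlongrightarrow> poly q 0) (at_right 0)" by (intro tendsto_poly tendsto_ident_at)
    have "0 \<le> poly q t" if "0 < t" for t
      using nonneg[OF that] that by (simp add: poly_p zero_le_mult_iff)
    then show "\<forall>\<^sub>F t in at_right 0. 0 \<le> poly q t"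
      by (auto intro: eventually_mono[OF eventually_at_right_less])
  qed simp
  then show ?thesis by (simp add: p_eq poly_0_coeff_0 numeral_2_eq_2)
qed

lemma real_choose_two: "real (n choose 2) = real n * (real n - 1) / 2"
  by (simp add: binomial_gbinomial gbinomial_prod_rev numeral_2_eq_2)

text \<open>The polynomials agree to first order at \<open>t = 0\<close>; the claim compares the second-order
  coefficients.\<close>
lemma poly_le_linear_power_coeffs:
  fixes p :: "real poly"
  assumes n_pos: "0 < n" and r_pos: "0 < r"
    and coeffs: "coeff p 0 = r ^ n" "coeff p 1 = n * D * r ^ (n - 1)"
    and bound: "\<And>t. 0 < t \<Longrightarrow> poly p t \<le> (r + D * t) ^ n"
  shows "2 * real n * coeff p 0 * coeff p 2 \<le> (real n - 1) * (coeff p 1)\<^sup>2"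
proof -
  define q where "q = [:r, D:] ^ n"
  have "coeff q 0 = r ^ n" "coeff q 1 = n * D * r ^ (n - 1)"
    using n_pos coeff_linear_poly_power[of _ n r D] by (simp_all add: q_def)
  then have "coeff p 2 \<le> coeff q 2"
    using coeff_2_nonneg[of "q - p"] coeffs bound by (simp add: q_def poly_power mult.commute)
  then have "2 * real n * coeff p 0 * coeff p 2 \<le> 2 * real n * r ^ n * coeff q 2"
    unfolding coeffs using r_pos by (intro mult_left_mono) auto
  also have "\<dots> = (real n - 1) * (coeff p 1)\<^sup>2"
  proof (cases "n = 1")
    case True
    then show ?thesis by (simp add: q_def numeral_2_eq_2)
  next
    case False
    then have "2 \<le> n" using n_pos by simp
    then obtain m where n_eq: "n = m + 2" by (metis add.commute le_Suc_ex)
    have second: "coeff q 2 = real n * (real n - 1) / 2 * D\<^sup>2 * r ^ m"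
      using coeff_linear_poly_power[of 2 n r D] by (simp add: q_def n_eq real_choose_two)
    show ?thesis unfolding second coeffs by (simp add: n_eq power2_eq_square power_add)
  qed
  finally show ?thesis .
qed

lemma root_concave_poly_coeffs:
  fixes p :: "real poly"
  assumes n_pos: "0 < n" and pos: "0 < coeff p 0" and nonneg: "\<And>t. 0 < t \<Longrightarrow> 0 \<le> poly p t"
    and concave: "\<And>s t. 0 < s \<Longrightarrow> s < t \<Longrightarrow>
      (1 - s / t) * root n (coeff p 0) + s / t * root n (poly p t) \<le> root n (poly p s)"
  shows "2 * real n * coeff p 0 * coeff p 2 \<le> (real n - 1) * (coeff p 1)\<^sup>2"
proof -
  define r where "r = root n (coeff p 0)"
  define D where "D = coeff p 1 / (n * r ^ (n - 1))"
  have r_root: "0 < r" "r ^ n = coeff p 0" using pos n_pos by (simp_all add: r_def)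
  have "((\<lambda>t. root n (poly p t)) has_real_derivative D) (at 0)"
  proof -
    have "(poly p has_real_derivative coeff p 1) (at 0)"
      using poly_DERIV[of p 0] by (simp add: poly_0_coeff_0 coeff_pderiv)
    then show ?thesis
      using DERIV_chain2[OF DERIV_real_root[OF n_pos], of "poly p" 0] pos
      by (simp add: D_def r_def poly_0_coeff_0 field_simps)
  qed
  then have deriv: "((\<lambda>t. root n (poly p t)) has_real_derivative D) (at_right 0)"
    by (rule DERIV_subset) simp
  have "poly p t \<le> (r + D * t) ^ n" if t_pos: "0 < t" for t
  proof -
    have "root n (poly p t) \<le> r + D * t"
      using concave_below_tangent_at_0[OF deriv t_pos] concave by (simp add: r_def poly_0_coeff_0)
    then have "root n (poly p t) ^ n \<le> (r + D * t) ^ n"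
      using nonneg[OF t_pos] n_pos by (intro power_mono) auto
    then show ?thesis using nonneg[OF t_pos] n_pos by simp
  qed
  moreover have "coeff p 1 = n * D * r ^ (n - 1)" using r_root n_pos by (simp add: D_def)
  ultimately show ?thesis
    using n_pos r_root by (intro poly_le_linear_power_coeffs) auto
qed

lemma scaleR_image_set_plus:
  fixes X Y :: "'a::real_vector set"
  shows "(*\<^sub>R) c ` (X + Y) = (*\<^sub>R) c ` X + (*\<^sub>R) c ` Y"
  by (force simp: set_plus_image image_image scaleR_add_right case_prod_beta)

lemma root_volume_scaleR:
  fixes S :: "'a::euclidean_space set"
  assumes "0 \<le> c"
  shows "root_volume ((*\<^sub>R) c ` S) = c * root_volume S"
proof -
  have "measure lebesgue ((*\<^sub>R) c ` S) = c ^ DIM('a) * measure lebesgue S"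
    using measure_lebesgue_affine[of c 0 S] assms by simp
  then show ?thesis using assms by (simp add: root_volume_def real_root_mult real_root_power_cancel)
qed

lemma root_volume_concave:
  fixes A L :: "'a::euclidean_space set"
  assumes body_A: "compact A" "convex A" "A \<noteq> {}" and compact_L: "compact L" "L \<noteq> {}"
    and less: "0 < s" "s < t"
  shows "(1 - s / t) * root_volume A + s / t * root_volume (A + (*\<^sub>R) t ` L)
    \<le> root_volume (A + (*\<^sub>R) s ` L)"
proof -
  define l where "l = s / t"
  have ratio: "0 \<le> l" "l \<le> 1" "l * t = s" using less by (auto simp: l_def)
  have "(*\<^sub>R) (1 - l) ` A + (*\<^sub>R) l ` (A + (*\<^sub>R) t ` L)
      = ((*\<^sub>R) (1 - l) ` A + (*\<^sub>R) l ` A) + (*\<^sub>R) s ` L"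
    unfolding ratio(3)[symmetric] by (simp add: scaleR_image_set_plus image_image add.assoc)
  also have "\<dots> = A + (*\<^sub>R) s ` L"
    using scaleR_image_add[OF body_A(2), of "1 - l" l] ratio by simp
  finally have decomposition: "(*\<^sub>R) (1 - l) ` A + (*\<^sub>R) l ` (A + (*\<^sub>R) t ` L) = A + (*\<^sub>R) s ` L" .
  have "brunn_minkowski ((*\<^sub>R) (1 - l) ` A) ((*\<^sub>R) l ` (A + (*\<^sub>R) t ` L))"
    using body_A compact_L
    by (intro brunn_minkowski_compact compact_scaling compact_set_plus) (auto simp: set_plus_def)
  then show ?thesis
    using ratio by (simp add: brunn_minkowski_def decomposition root_volume_scaleR l_def[symmetric])
qed

theorem minkowski_quadratic_inequality:
  fixes A L :: "(real^'n::finite) set"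
  assumes dim: "CARD('n) \<ge> 2" and body_A: "convex_body A" and body_L: "convex_body L"
  shows "measure lebesgue A * mixed_volume (L # L # replicate (CARD('n) - 2) A)
    \<le> (mixed_volume (L # replicate (CARD('n) - 1) A))\<^sup>2"
proof (cases "measure lebesgue A = 0")
  case False
  define V where "V d = mixed_volume (replicate d L @ replicate (CARD('n) - d) A)" for d
  define p where "p = (\<Sum>d\<le>CARD('n). monom (real (CARD('n) choose d) * V d) d)"
  have poly_p: "poly p t = measure lebesgue (A + (*\<^sub>R) t ` L)" if "0 \<le> t" for t
    using volume_steiner_polynomial[OF body_A body_L that]
    by (simp add: p_def poly_sum poly_monom V_def)
  have coeff_p: "coeff p d = real (CARD('n) choose d) * V d" if "d \<le> CARD('n)" for d
    using that by (simp add: p_def coeff_sum)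
  have bodies: "compact A" "convex A" "A \<noteq> {}" "compact L" "L \<noteq> {}"
    using body_A body_L by (auto simp: convex_body_def)
  have volume_A: "coeff p 0 = measure lebesgue A"
    using poly_p[of 0] bodies by (simp add: poly_0_coeff_0 image_constant_conv)
  have "2 * real CARD('n) * coeff p 0 * coeff p 2 \<le> (real CARD('n) - 1) * (coeff p 1)\<^sup>2"
  proof (rule root_concave_poly_coeffs)
    show "0 < coeff p 0" using False by (simp add: volume_A zero_less_measure_iff)
    show "(1 - s / t) * root CARD('n) (coeff p 0) + s / t * root CARD('n) (poly p t)
        \<le> root CARD('n) (poly p s)"
      if "0 < s" "s < t" for s t
      using root_volume_concave[OF bodies that] that by (simp add: poly_p volume_A root_volume_def)
  qed (simp_all add: poly_p)
  also have "coeff p 1 = CARD('n) * V 1" using dim by (simp add: coeff_p)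
  also have "coeff p 2 = real CARD('n) * (real CARD('n) - 1) / 2 * V 2"
    using dim by (simp add: coeff_p real_choose_two)
  finally have "(real CARD('n) ^ 2 * (real CARD('n) - 1)) * (measure lebesgue A * V 2)
      \<le> (real CARD('n) ^ 2 * (real CARD('n) - 1)) * (V 1)\<^sup>2"
    by (simp add: volume_A power2_eq_square mult_ac)
  moreover have "0 < real CARD('n) ^ 2 * (real CARD('n) - 1)" using dim by simp
  ultimately have "measure lebesgue A * V 2 \<le> (V 1)\<^sup>2" by (rule mult_left_le_imp_le)
  then show ?thesis by (simp add: V_def numeral_2_eq_2)
qed simp

section \<open>The Bezout inequality\<close>

lemma bilinear_bound:
  fixes c p q :: real
  assumes "0 \<le> p" "0 \<le> q" and quadratic: "\<And>x y. 0 \<le> x \<Longrightarrow> 0 \<le> y \<Longrightarrow> 2 * c * (x * y) \<le> (x * p + y * q)\<^sup>2"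
  shows "c \<le> 2 * p * q"
proof (rule tendsto_lowerbound)
  show "((\<lambda>e. 2 * (p + e) * (q + e)) \<longlongrightarrow> 2 * p * q) (at_right 0)"
    by (rule tendsto_eq_intros refl | simp)+
  have "c \<le> 2 * (p + e) * (q + e)" if e_pos: "0 < e" for e
  proof -
    define z where "z = (q + e) * (p + e)"
    have z_pos: "0 < z" using assms e_pos by (simp add: z_def)
    have "2 * c * z \<le> ((q + e) * p + (p + e) * q)\<^sup>2"
      unfolding z_def using assms e_pos by (intro quadratic) auto
    also have "\<dots> \<le> (2 * z)\<^sup>2"
      unfolding z_def using assms e_pos by (intro power_mono) (auto simp: algebra_simps)
    also have "\<dots> = 2 * (2 * z) * z" by (simp add: power2_eq_square)
    finally have "2 * c \<le> 2 * (2 * z)" using z_pos by (rule mult_right_le_imp_le)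
    then have "c \<le> 2 * z" by simp
    then show ?thesis by (simp only: z_def mult_ac)
  qed
  then show "\<forall>\<^sub>F e in at_right 0. c \<le> 2 * (p + e) * (q + e)"
    by (auto intro: eventually_mono[OF eventually_at_right_less])
qed simp

lemma convex_body_lincomb:
  assumes "convex_body K" "convex_body L"
  shows "convex_body ((*\<^sub>R) x ` K + (*\<^sub>R) y ` L)"
  using assms unfolding convex_body_def
  by (intro conjI compact_set_plus compact_scaling convex_set_plus convex_scaling)
    (auto simp: set_plus_def)

lemma mixed_volume_quadratic_expansion:
  fixes K L :: "(real^'n::finite) set"
  assumes body_K: "convex_body K" and body_L: "convex_body L" and nonneg: "0 \<le> x" "0 \<le> y"
    and bodies_Ms: "Suc (Suc (length Ms)) = CARD('n)" "\<And>M. M \<in> set Ms \<Longrightarrow> convex_body M"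
  defines "B \<equiv> (*\<^sub>R) x ` K + (*\<^sub>R) y ` L"
  shows "mixed_volume (B # B # Ms) = x\<^sup>2 * mixed_volume (K # K # Ms)
    + 2 * x * y * mixed_volume (K # L # Ms) + y\<^sup>2 * mixed_volume (L # L # Ms)"
proof -
  have body_B: "convex_body B" unfolding B_def using body_K body_L by (rule convex_body_lincomb)
  have linear: "mixed_volume (B # M # Ms)
      = x * mixed_volume (K # M # Ms) + y * mixed_volume (L # M # Ms)"
    if "convex_body M" for M
    unfolding B_def using body_K body_L nonneg bodies_Ms that by (intro mixed_volume_linear) auto
  have swap: "mixed_volume (M # M' # Ms) = mixed_volume (M' # M # Ms)" for M M'
    using bodies_Ms(1) by (intro mixed_volume_mset_cong) auto
  have "mixed_volume (B # B # Ms) = x * mixed_volume (B # K # Ms) + y * mixed_volume (B # L # Ms)"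
    unfolding linear[OF body_B] swap[of K B] swap[of L B] ..
  also have "\<dots> = x\<^sup>2 * mixed_volume (K # K # Ms) + 2 * x * y * mixed_volume (K # L # Ms)
      + y\<^sup>2 * mixed_volume (L # L # Ms)"
    unfolding linear[OF body_K] linear[OF body_L] swap[of L K]
    by (simp add: power2_eq_square algebra_simps)
  finally show ?thesis .
qed

lemma mixed_volume_cross_term_le:
  fixes K L :: "(real^'n::finite) set"
  assumes bodies: "convex_body K" "convex_body L" and nonneg: "0 \<le> x" "0 \<le> y"
    and bodies_Ms: "Suc (Suc (length Ms)) = CARD('n)" "\<And>M. M \<in> set Ms \<Longrightarrow> convex_body M"
  defines "B \<equiv> (*\<^sub>R) x ` K + (*\<^sub>R) y ` L"
  shows "2 * x * y * mixed_volume (K # L # Ms) \<le> mixed_volume (B # B # Ms)"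
proof -
  have "0 \<le> mixed_volume (M # M # Ms)" if "convex_body M" for M
    using that bodies_Ms by (intro mixed_volume_nonneg) auto
  then show ?thesis
    using mixed_volume_quadratic_expansion[OF bodies nonneg bodies_Ms] bodies by (simp add: B_def)
qed

theorem theorem1p5:
  fixes A K1 K2 :: "(real^'n::finite) set"
  assumes "CARD('n) \<ge> 2"
    and "convex_body A" and "convex_body K1" and "convex_body K2"
  shows "measure lebesgue A * mixed_volume ([K1, K2] @ replicate (CARD('n) - 2) A)
         \<le> 2 * mixed_volume (K1 # replicate (CARD('n) - 1) A)
             * mixed_volume (K2 # replicate (CARD('n) - 1) A)"
proof (rule bilinear_bound)
  show "0 \<le> mixed_volume (K1 # replicate (CARD('n) - 1) A)"
    "0 \<le> mixed_volume (K2 # replicate (CARD('n) - 1) A)"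
    using assms by (auto intro!: mixed_volume_nonneg)
  fix x y :: real assume nonneg: "0 \<le> x" "0 \<le> y"
  define B where "B = (*\<^sub>R) x ` K1 + (*\<^sub>R) y ` K2"
  let ?V = "\<lambda>K L. mixed_volume (K # L # replicate (CARD('n) - 2) A)"
  have "measure lebesgue A * (2 * x * y * ?V K1 K2) \<le> measure lebesgue A * ?V B B"
    unfolding B_def using assms nonneg by (intro mult_left_mono mixed_volume_cross_term_le) auto
  also have "\<dots> \<le> (mixed_volume (B # replicate (CARD('n) - 1) A))\<^sup>2"
    unfolding B_def using assms by (intro minkowski_quadratic_inequality convex_body_lincomb)
  also have "mixed_volume (B # replicate (CARD('n) - 1) A)
      = x * mixed_volume (K1 # replicate (CARD('n) - 1) A)
        + y * mixed_volume (K2 # replicate (CARD('n) - 1) A)"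
    unfolding B_def using assms nonneg by (intro mixed_volume_linear) auto
  finally show "2 * (measure lebesgue A * mixed_volume ([K1, K2] @ replicate (CARD('n) - 2) A))
        * (x * y)
      \<le> (x * mixed_volume (K1 # replicate (CARD('n) - 1) A)
        + y * mixed_volume (K2 # replicate (CARD('n) - 1) A))\<^sup>2"
    by (simp add: mult_ac)
qed

end
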